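(* Let $\mathcal{F}=\{f_i\}_{i=1}^m$ be a frame for $\mathbb{C}^n$ with synthesis operator $F:\mathbb{C}^m\to\mathbb{C}^n$. Denote by $\lambda=(\lambda_i)_{i=1}^m$ the eigenvalues of the Gramian $F^*F\in M_m(\mathbb{C})$, counting multiplicities and arranged in non-increasing order. Consider the positive numbers $(d_j)_{j=1}^n$ defined for $1\le j\le n$ by $$d_j=\begin{cases}\lambda_{m-n+j} & \text{if } \lambda_{m-n+j}\ge 1,\\ 1 & \text{if } \lambda_{m-n+j}<1\le \lambda_j,\\ \lambda_j & \text{if } \lambda_j<1.\end{cases}$$ Then: 1. There exists a Parseval frame $\mathcal{X}=\{x_i\}_{i=1}^m$ for $\mathbb{C}^n$ with synthesis operator $X$ such that $FX^*$ is positive semidefinite with eigenvalues $(d_j^{1/2})_{j=1}^n$. 2. With $X$ as in item 1, for every unitarily invariant norm $|\!|\!|\cdot|\!|\!|$ on $M_n(\mathbb{C})$ and every Parseval frame $\mathcal{Y}=\{y_i\}_{i=1}^m$ for $\mathbb{C}^n$ with synthesis operator $Y$, we have $|\!|\!|FX^*-I|\!|\!|\le |\!|\!|FY^*-I|\!|\!|$. 3. If $\Phi:\mathbb{R}^n\to\mathbb{R}_{\ge 0}$ denotes the symmetric gauge function associated with the unitarily invariant norm $|\!|\!|\cdot|\!|\!|$, then $\alpha_{|\!|\!|\cdot|\!|\!|}(\mathcal{F})=\Phi\big((1-d_j^{1/2})_{j=1}^n\big)$.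
   Context: A finite sequence $\mathcal{F}=\{f_i\}_{i=1}^m$ in $\mathbb{C}^n$ is a frame for $\mathbb{C}^n$ if there are $A,B>0$ with $A\|f\|^2\le\sum_{i=1}^m|\langle f,f_i\rangle|^2\le B\|f\|^2$ for all $f\in\mathbb{C}^n$; it is Parseval if one can take $A=B=1$. Its synthesis operator is $F:\mathbb{C}^m\to\mathbb{C}^n$, $F((a_i)_{i=1}^m)=\sum_{i=1}^m a_if_i$. A frame is Parseval iff its synthesis operator $X$ satisfies $XX^*=I$. A unitarily invariant norm on $M_n(\mathbb{C})$ is a norm with $|\!|\!|UAV|\!|\!|=|\!|\!|A|\!|\!|$ for all $A$ and all unitary $U,V$; its associated symmetric gauge function $\Phi$ is the norm on $\mathbb{R}^n$, invariant under permutations and sign changes of coordinates, with $|\!|\!|A|\!|\!|=\Phi(s(A))$, where $s(A)\in\mathbb{R}^n$ is the vector of singular values of $A$. Define $$\alpha_{|\!|\!|\cdot|\!|\!|}(\mathcal{F}):=\min\{|\!|\!|FX^*-I|\!|\!|:\ X\in M_{n,m}(\mathbb{C}),\ XX^*=I\}.$$ *)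

theory Defs
  imports "Jordan_Normal_Form.Spectral_Radius" "Jordan_Normal_Form.Schur_Decomposition"
begin

text \<open>The inner product on \<open>\<complex>\<^sup>n\<close> is \<^term>\<open>v \<bullet>c w\<close>, linear in the first argument.\<close>

definition vnorm :: "complex vec \<Rightarrow> real" where
  "vnorm v = sqrt (Re (v \<bullet>c v))"

definition frame_bounds :: "nat \<Rightarrow> complex vec list \<Rightarrow> real \<Rightarrow> real \<Rightarrow> bool" where
  "frame_bounds n fs A B \<longleftrightarrow>
     (\<forall>f \<in> carrier_vec n.
        A * (vnorm f)\<^sup>2 \<le> (\<Sum>i<length fs. (cmod (f \<bullet>c (fs ! i)))\<^sup>2) \<and>
        (\<Sum>i<length fs. (cmod (f \<bullet>c (fs ! i)))\<^sup>2) \<le> B * (vnorm f)\<^sup>2)"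

definition is_frame :: "nat \<Rightarrow> complex vec list \<Rightarrow> bool" where
  "is_frame n fs \<longleftrightarrow> set fs \<subseteq> carrier_vec n \<and> (\<exists>A>0. \<exists>B>0. frame_bounds n fs A B)"

definition is_parseval_frame :: "nat \<Rightarrow> complex vec list \<Rightarrow> bool" where
  "is_parseval_frame n fs \<longleftrightarrow> set fs \<subseteq> carrier_vec n \<and> frame_bounds n fs 1 1"

text \<open>The synthesis operator \<open>a \<mapsto> \<Sum>\<^sub>i a\<^sub>i f\<^sub>i\<close>, as a matrix: its columns are the \<open>f\<^sub>i\<close>.\<close>

definition synthesis :: "nat \<Rightarrow> complex vec list \<Rightarrow> complex mat" where
  "synthesis n fs = mat_of_cols n fs"

lemma synthesis_apply:
  assumes "a \<in> carrier_vec (length fs)" "set fs \<subseteq> carrier_vec n"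
  shows "synthesis n fs *\<^sub>v a = finsum_vec TYPE(complex) n (\<lambda>i. (a $ i) \<cdot>\<^sub>v (fs ! i)) {..<length fs}"
proof (rule eq_vecI)
  have c: "(\<lambda>i. (a $ i) \<cdot>\<^sub>v (fs ! i)) \<in> {..<length fs} \<rightarrow> carrier_vec n"
    using assms by (auto simp: subset_iff)
  show d: "dim_vec (synthesis n fs *\<^sub>v a)
      = dim_vec (finsum_vec TYPE(complex) n (\<lambda>i. (a $ i) \<cdot>\<^sub>v (fs ! i)) {..<length fs})"
    using finsum_vec_closed[OF c] by (simp add: synthesis_def)
  fix k
  assume "k < dim_vec (finsum_vec TYPE(complex) n (\<lambda>i. (a $ i) \<cdot>\<^sub>v (fs ! i)) {..<length fs})"
  then have k: "k < n" using finsum_vec_closed[OF c] by simp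
  have "dim_vec (fs ! i) = n" if "i < length fs" for i
    using assms that by (meson carrier_vecD nth_mem subset_iff)
  then show "(synthesis n fs *\<^sub>v a) $ k
      = finsum_vec TYPE(complex) n (\<lambda>i. (a $ i) \<cdot>\<^sub>v (fs ! i)) {..<length fs} $ k"
    using k assms(1) c
    by (auto simp: index_finsum_vec synthesis_def scalar_prod_def mult_mat_vec_def
        mat_of_cols_def row_def atLeast0LessThan mult.commute intro!: sum.cong)
qed

definition has_eigenvalues :: "complex mat \<Rightarrow> real list \<Rightarrow> bool" where
  "has_eigenvalues A xs \<longleftrightarrow> char_poly A = (\<Prod>x\<leftarrow>xs. [:- complex_of_real x, 1:])"

text \<open>Only meaningful for matrices with real spectrum; for Hermitian matrices see
  \<open>eigvals_desc_hermitian\<close> below.\<close>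

definition eigvals_desc :: "complex mat \<Rightarrow> real list" where
  "eigvals_desc A = (THE xs. has_eigenvalues A xs \<and> sorted_wrt (\<ge>) xs)"

definition hermitian_mat :: "complex mat \<Rightarrow> bool" where
  "hermitian_mat A \<longleftrightarrow> mat_adjoint A = A"

definition psd :: "nat \<Rightarrow> complex mat \<Rightarrow> bool" where
  "psd n A \<longleftrightarrow> A \<in> carrier_mat n n \<and> hermitian_mat A \<and>
     (\<forall>v \<in> carrier_vec n. 0 \<le> Re ((A *\<^sub>v v) \<bullet>c v))"

definition sing_vals :: "complex mat \<Rightarrow> real vec" where
  "sing_vals A = vec_of_list (map sqrt (eigvals_desc (mat_adjoint A * A)))"

lemma order_linear_factors:
  "order a (\<Prod>x\<leftarrow>xs. [:- (f x), 1:]) = length (filter (\<lambda>x. f x = a) xs)" for a :: complex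
proof (induction xs)
  case Nil
  then show ?case by (simp add: order_0I)
next
  case (Cons x xs)
  have nz: "(\<Prod>x\<leftarrow>xs. [:- (f x), 1:]) \<noteq> 0" by (auto simp: prod_list_zero_iff)
  have "order a [:- (f x), 1:] = (if f x = a then 1 else 0)"
  proof (cases "f x = a")
    case True
    then show ?thesis using order_power_n_n[of a 1] by simp
  next
    case False
    then show ?thesis by (simp add: order_0I)
  qed
  moreover have "order a ([:- (f x), 1:] * (\<Prod>x\<leftarrow>xs. [:- (f x), 1:]))
      = order a [:- (f x), 1:] + order a (\<Prod>x\<leftarrow>xs. [:- (f x), 1:])"
    by (rule order_mult) (use nz in \<open>simp add: del: mult_pCons_left\<close>)
  ultimately show ?case using Cons by (simp del: mult_pCons_left)
qed

lemma has_eigenvalues_unique: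
  assumes "has_eigenvalues A xs" "has_eigenvalues A ys"
  shows "mset xs = mset ys"
proof (rule multiset_eqI)
  fix x :: real
  have "length (filter (\<lambda>y. complex_of_real y = of_real x) xs)
      = length (filter (\<lambda>y. complex_of_real y = of_real x) ys)"
    using assms order_linear_factors[of "of_real x" complex_of_real]
    unfolding has_eigenvalues_def by metis
  moreover have "filter ((=) x) zs = filter (\<lambda>y. complex_of_real y = of_real x) zs" for zs
    by (rule filter_cong) auto
  ultimately show "count (mset xs) x = count (mset ys) x"
    by (simp only: count_mset count_list_eq_length_filter)
qed

lemma hermitian_eigenvalue_real:
  assumes A: "A \<in> carrier_mat n n" and h: "hermitian_mat A" and e: "eigenvalue A a"
  shows "a \<in> \<real>"
proof -
  obtain v where v: "v \<in> carrier_vec n" "v \<noteq> 0\<^sub>v n" "A *\<^sub>v v = a \<cdot>\<^sub>v v"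
    using e A unfolding eigenvalue_def eigenvector_def by auto
  have ij: "A $$ (j, i) = cnj (A $$ (i, j))" if "i < n" "j < n" for i j
  proof -
    have "mat_adjoint A $$ (j, i) = cnj (A $$ (i, j))"
      using that A by (simp add: mat_adjoint_def mat_of_rows_def)
    then show ?thesis using h unfolding hermitian_mat_def by simp
  qed
  have eq: "(A *\<^sub>v v) \<bullet>c v = a * (v \<bullet>c v)" using v by simp
  have ex: "(A *\<^sub>v v) \<bullet>c v = (\<Sum>i<n. \<Sum>j<n. A $$ (i, j) * v $ j * cnj (v $ i))"
    using v(1) A by (simp add: scalar_prod_def atLeast0LessThan sum_distrib_right)
  have "cnj ((A *\<^sub>v v) \<bullet>c v) = (\<Sum>i<n. \<Sum>j<n. A $$ (j, i) * cnj (v $ j) * v $ i)"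
  proof -
    have "cnj (A $$ (i, j)) * cnj (v $ j) * v $ i = A $$ (j, i) * cnj (v $ j) * v $ i"
      if "i < n" "j < n" for i j
      using ij[OF that] by (simp only:)
    then have "(\<Sum>i<n. \<Sum>j<n. cnj (A $$ (i, j)) * cnj (v $ j) * v $ i)
        = (\<Sum>i<n. \<Sum>j<n. A $$ (j, i) * cnj (v $ j) * v $ i)"
      by (intro sum.cong refl) (simp only: lessThan_iff)
    then show ?thesis unfolding ex by simp
  qed
  also have "\<dots> = (A *\<^sub>v v) \<bullet>c v"
    unfolding ex by (subst sum.swap) (simp add: mult_ac)
  finally have 1: "cnj (a * (v \<bullet>c v)) = a * (v \<bullet>c v)" unfolding eq .
  have 2: "cnj (v \<bullet>c v) = v \<bullet>c v"
    by (simp add: scalar_prod_def mult.commute)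
  have "v \<bullet>c v \<noteq> 0" using v conjugate_square_eq_0_vec by blast
  with 1 2 have "cnj a = a" by simp
  then show ?thesis by (simp add: Reals_cnj_iff)
qed

lemma eigvals_desc_hermitian:
  assumes A: "A \<in> carrier_mat n n" and h: "hermitian_mat A"
  shows "has_eigenvalues A (eigvals_desc A)" "sorted_wrt (\<ge>) (eigvals_desc A)"
    "length (eigvals_desc A) = n"
proof -
  obtain as where as: "char_poly A = (\<Prod>a\<leftarrow>as. [:- a, 1:])" "length as = n"
    using char_poly_factorized[OF A] by blast
  have "a \<in> \<real>" if "a \<in> set as" for a
  proof -
    have "poly (char_poly A) a = 0" unfolding as(1)
      using that by (induction as) auto
    then show ?thesis
      using eigenvalue_root_char_poly[OF A] hermitian_eigenvalue_real[OF A h] by blast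
  qed
  then have as': "map (complex_of_real \<circ> Re) as = as"
    by (auto simp: map_idI)
  define xs where "xs = rev (sort (map Re as))"
  have "(\<Prod>x\<leftarrow>xs. [:- complex_of_real x, 1:])
      = (\<Prod>x\<leftarrow>map Re as. [:- complex_of_real x, 1:])"
  proof -
    have "mset xs = mset (map Re as)" unfolding xs_def by simp
    then have "mset (map g xs) = mset (map g (map Re as))" for g :: "real \<Rightarrow> complex poly"
      unfolding mset_map by (rule arg_cong)
    then show ?thesis unfolding prod_mset_prod_list[symmetric] by (rule arg_cong)
  qed
  also have "\<dots> = (\<Prod>x\<leftarrow>map (complex_of_real \<circ> Re) as. [:- x, 1:])"
    by (simp add: o_def)
  also have "\<dots> = char_poly A" unfolding as' as(1) ..
  finally have 1: "has_eigenvalues A xs" unfolding has_eigenvalues_def by simp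
  have 2: "sorted_wrt (\<ge>) xs" unfolding xs_def by (simp add: sorted_wrt_rev)
  have "ys = xs" if "has_eigenvalues A ys \<and> sorted_wrt (\<ge>) ys" for ys
  proof -
    have "mset (rev ys) = mset (rev xs)" using has_eigenvalues_unique[of A ys xs] that 1 by simp
    moreover have "sorted (rev ys)" "sorted (rev xs)"
      using that 2 by (simp_all add: sorted_wrt_rev)
    ultimately have "rev ys = rev xs" by (metis properties_for_sort)
    then show ?thesis by simp
  qed
  then have "eigvals_desc A = xs" unfolding eigvals_desc_def using 1 2 by blast
  with 1 2 as(2) show "has_eigenvalues A (eigvals_desc A)" "sorted_wrt (\<ge>) (eigvals_desc A)"
    "length (eigvals_desc A) = n" by (simp_all add: xs_def)
qed

lemma hermitian_gram: "hermitian_mat (mat_adjoint A * A)"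
proof -
  have dims: "dim_row (mat_adjoint B) = dim_col B" "dim_col (mat_adjoint B) = dim_row B"
    for B :: "complex mat"
    by (simp_all add: mat_adjoint_def)
  have adj: "mat_adjoint B $$ (i, j) = cnj (B $$ (j, i))"
    if "i < dim_col B" "j < dim_row B" for B :: "complex mat" and i j
    using that by (simp add: mat_adjoint_def mat_of_rows_def)
  have gram: "(mat_adjoint A * A) $$ (i, j) = (\<Sum>k<dim_row A. cnj (A $$ (k, i)) * A $$ (k, j))"
    if "i < dim_col A" "j < dim_col A" for i j
    using that by (simp add: scalar_prod_def dims adj atLeast0LessThan)
  show ?thesis
    unfolding hermitian_mat_def
  proof (rule eq_matI)
    fix i j
    assume "i < dim_row (mat_adjoint A * A)" "j < dim_col (mat_adjoint A * A)"
    then have ij: "i < dim_col A" "j < dim_col A" by (simp_all add: dims)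
    have "mat_adjoint (mat_adjoint A * A) $$ (i, j) = cnj ((mat_adjoint A * A) $$ (j, i))"
      using ij by (intro adj) (simp_all add: dims)
    then show "mat_adjoint (mat_adjoint A * A) $$ (i, j) = (mat_adjoint A * A) $$ (i, j)"
      unfolding gram[OF ij] gram[OF ij(2,1)] by (simp add: mult_ac)
  qed (simp_all add: dims)
qed

definition unitary_mat :: "nat \<Rightarrow> complex mat \<Rightarrow> bool" where
  "unitary_mat n U \<longleftrightarrow> U \<in> carrier_mat n n \<and>
     U * mat_adjoint U = 1\<^sub>m n \<and> mat_adjoint U * U = 1\<^sub>m n"

definition matrix_norm :: "nat \<Rightarrow> (complex mat \<Rightarrow> real) \<Rightarrow> bool" where
  "matrix_norm n N \<longleftrightarrow>
     (\<forall>A \<in> carrier_mat n n. 0 \<le> N A \<and> (N A = 0 \<longleftrightarrow> A = 0\<^sub>m n n)) \<and>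
     (\<forall>A \<in> carrier_mat n n. \<forall>c. N (c \<cdot>\<^sub>m A) = cmod c * N A) \<and>
     (\<forall>A \<in> carrier_mat n n. \<forall>B \<in> carrier_mat n n. N (A + B) \<le> N A + N B)"

definition unitarily_invariant_norm :: "nat \<Rightarrow> (complex mat \<Rightarrow> real) \<Rightarrow> bool" where
  "unitarily_invariant_norm n N \<longleftrightarrow> matrix_norm n N \<and>
     (\<forall>A \<in> carrier_mat n n. \<forall>U V. unitary_mat n U \<and> unitary_mat n V \<longrightarrow> N (U * A * V) = N A)"

definition symmetric_gauge :: "nat \<Rightarrow> (real vec \<Rightarrow> real) \<Rightarrow> bool" where
  "symmetric_gauge n \<Phi> \<longleftrightarrow>
     (\<forall>x \<in> carrier_vec n. 0 \<le> \<Phi> x \<and> (\<Phi> x = 0 \<longleftrightarrow> x = 0\<^sub>v n)) \<and>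
     (\<forall>x \<in> carrier_vec n. \<forall>c. \<Phi> (c \<cdot>\<^sub>v x) = \<bar>c\<bar> * \<Phi> x) \<and>
     (\<forall>x \<in> carrier_vec n. \<forall>y \<in> carrier_vec n. \<Phi> (x + y) \<le> \<Phi> x + \<Phi> y) \<and>
     (\<forall>x \<in> carrier_vec n. \<forall>\<pi>. \<pi> permutes {..<n} \<longrightarrow> \<Phi> (vec n (\<lambda>i. x $ \<pi> i)) = \<Phi> x) \<and>
     (\<forall>x \<in> carrier_vec n. \<forall>\<epsilon>. (\<forall>i<n. \<epsilon> i \<in> {-1, 1}) \<longrightarrow> \<Phi> (vec n (\<lambda>i. \<epsilon> i * x $ i)) = \<Phi> x)"

definition associated_gauge :: "nat \<Rightarrow> (complex mat \<Rightarrow> real) \<Rightarrow> (real vec \<Rightarrow> real) \<Rightarrow> bool" where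
  "associated_gauge n N \<Phi> \<longleftrightarrow> symmetric_gauge n \<Phi> \<and>
     (\<forall>A \<in> carrier_mat n n. N A = \<Phi> (sing_vals A))"

definition parseval_errors :: "nat \<Rightarrow> nat \<Rightarrow> (complex mat \<Rightarrow> real) \<Rightarrow> complex mat \<Rightarrow> real set" where
  "parseval_errors n m N F =
     {N (F * mat_adjoint X - 1\<^sub>m n) |X. X \<in> carrier_mat n m \<and> X * mat_adjoint X = 1\<^sub>m n}"

text \<open>An infimum here; it is a minimum precisely when it belongs to \<^const>\<open>parseval_errors\<close>.\<close>

definition alpha :: "nat \<Rightarrow> (complex mat \<Rightarrow> real) \<Rightarrow> complex vec list \<Rightarrow> real" where
  "alpha n N fs = Inf (parseval_errors n (length fs) N (synthesis n fs))"

text \<open>Indices are 0-based: \<open>d_seq n m lam j\<close> is \<open>d\<^sub>j\<^sub>+\<^sub>1\<close> and \<open>lam ! i\<close> is \<open>\<lambda>\<^sub>i\<^sub>+\<^sub>1\<close>. A frame has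
  \<open>n \<le> m\<close>, so the subtraction is not truncated.\<close>

definition d_seq :: "nat \<Rightarrow> nat \<Rightarrow> real list \<Rightarrow> nat \<Rightarrow> real" where
  "d_seq n m lam j =
     (if lam ! (m - n + j) \<ge> 1 then lam ! (m - n + j)
      else if lam ! j \<ge> 1 then 1
      else lam ! j)"

end

theory Submission
  imports Defs
begin

text \<open>For a coisometry \<open>Y\<close>, Cauchy interlacing puts the squared singular values of \<open>F Y\<^sup>*\<close>
  between \<open>\<lambda>\<^bsub>m-n+j\<^esub>\<close> and \<open>\<lambda>\<^sub>j\<close>, and \<open>d\<^sub>j\<close> is the point of this interval closest to \<open>1\<close>.
  Mirsky's inequality (Lidskii's theorem for the Hermitian dilations of \<open>F Y\<^sup>*\<close> and \<open>I\<close>) says that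
  the singular values of \<open>F Y\<^sup>* - I\<close> weakly majorize \<open>\<bar>s\<^sub>j(F Y\<^sup>*) - 1\<bar>\<close>, hence every unitarily
  invariant norm of \<open>F Y\<^sup>* - I\<close> is at least that of the diagonal matrix with entries
  \<open>d\<^sub>j\<^bsup>1/2\<^esup> - 1\<close>. Equality is attained because an eigenvector of \<open>F\<^sup>* F\<close> with eigenvalue at
  least \<open>1\<close> can be rotated towards a kernel vector until its image under \<open>F\<close> has norm \<open>1\<close>.\<close>

section \<open>Orthonormal bases and the spectral theorem\<close>

text \<open>Lower bound and construction meet because the identity is diagonal in every basis: an
  eigenbasis of \<open>F * mat_adjoint X\<close> with eigenvalues \<open>sqrt (d j)\<close> also
  diagonalizes the difference with the identity, with entries \<open>sqrt (d j) - 1\<close>. The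
  shift by \<open>m - n\<close> is the dimension of the kernel of \<open>F\<close>. The frame
  condition makes exactly \<open>n\<close> eigenvalues of the Gramian positive, and each rotation
  that lowers a singular value to 1 uses up one kernel direction. If more than \<open>m - n\<close>
  eigenvalues are at least 1, the largest \<open>m - n\<close> are lowered and the others stay. Item
  2 concerns a norm \<open>N\<close> with no gauge function at hand. The theory of majorization is
  therefore carried out for the function that sends x to \<open>N (real_diag n x)\<close>, whose
  invariance under permutations and sign changes comes from unitary invariance.\<close>

lemma cscalar_prod_eq_sum:
  fixes v w :: "complex vec"
  assumes "v \<in> carrier_vec n" "w \<in> carrier_vec n"
  shows "v \<bullet>c w = (\<Sum>i<n. v $ i * cnj (w $ i))"
  using assms by (auto simp: scalar_prod_def atLeast0LessThan intro!: sum.cong)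

lemma cnj_cscalar_prod:
  fixes v w :: "complex vec"
  assumes "v \<in> carrier_vec n" "w \<in> carrier_vec n"
  shows "cnj (v \<bullet>c w) = w \<bullet>c v"
  using assms by (simp add: cscalar_prod_eq_sum mult.commute)

lemma cscalar_prod_self:
  fixes v :: "complex vec"
  assumes "v \<in> carrier_vec n"
  shows "v \<bullet>c v = of_real (\<Sum>i<n. (cmod (v $ i))\<^sup>2)"
  using assms by (simp add: cscalar_prod_eq_sum complex_norm_square del: of_real_power)

lemma cscalar_prod_self_pos:
  fixes v :: "complex vec"
  assumes v: "v \<in> carrier_vec n" and "v \<noteq> 0\<^sub>v n"
  shows "0 < Re (v \<bullet>c v)"
proof -
  have "v \<bullet>c v > 0" using assms conjugate_square_greater_0_vec[OF v] by blast
  then show ?thesis by (simp add: less_complex_def)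
qed

lemma cscalar_prod_smult_left:
  fixes v w :: "complex vec"
  assumes "v \<in> carrier_vec n" "w \<in> carrier_vec n"
  shows "(c \<cdot>\<^sub>v v) \<bullet>c w = c * (v \<bullet>c w)"
  using assms by (simp add: cscalar_prod_eq_sum sum_distrib_left mult_ac)

lemma cscalar_prod_smult_right:
  fixes v w :: "complex vec"
  assumes "v \<in> carrier_vec n" "w \<in> carrier_vec n"
  shows "v \<bullet>c (c \<cdot>\<^sub>v w) = cnj c * (v \<bullet>c w)"
  using assms by (simp add: cscalar_prod_eq_sum sum_distrib_left mult_ac)

section \<open>The adjoint of a complex matrix\<close>

lemma mat_adjoint_dims [simp]:
  "dim_row (mat_adjoint A) = dim_col A" "dim_col (mat_adjoint A) = dim_row A"
  by (simp_all add: mat_adjoint_def)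

lemma mat_adjoint_carrier [simp, intro]:
  "A \<in> carrier_mat p q \<Longrightarrow> mat_adjoint A \<in> carrier_mat q p"
  by (auto intro: carrier_matI)

lemma index_mat_adjoint [simp]:
  fixes A :: "complex mat"
  assumes "i < dim_col A" "j < dim_row A"
  shows "mat_adjoint A $$ (i, j) = cnj (A $$ (j, i))"
  using assms by (simp add: mat_adjoint_def mat_of_rows_def)

lemma mat_adjoint_adjoint [simp]: "mat_adjoint (mat_adjoint A) = (A :: complex mat)"
  by (rule eq_matI) simp_all

lemma mat_adjoint_mult:
  fixes A B :: "complex mat"
  assumes "A \<in> carrier_mat p q" "B \<in> carrier_mat q r"
  shows "mat_adjoint (A * B) = mat_adjoint B * mat_adjoint A"
  using assms by (intro eq_matI) (auto simp: scalar_prod_def mult.commute)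

lemma cscalar_prod_adjoint:
  fixes A :: "complex mat"
  assumes A: "A \<in> carrier_mat p q" and v: "v \<in> carrier_vec q" and w: "w \<in> carrier_vec p"
  shows "(A *\<^sub>v v) \<bullet>c w = v \<bullet>c (mat_adjoint A *\<^sub>v w)"
proof -
  have "(A *\<^sub>v v) \<bullet>c w = (\<Sum>i<p. \<Sum>j<q. A $$ (i, j) * v $ j * cnj (w $ i))"
    using assms by (simp add: scalar_prod_def atLeast0LessThan sum_distrib_right)
  also have "\<dots> = (\<Sum>j<q. \<Sum>i<p. A $$ (i, j) * v $ j * cnj (w $ i))"
    by (rule sum.swap)
  also have "\<dots> = v \<bullet>c (mat_adjoint A *\<^sub>v w)"
    using assms by (simp add: scalar_prod_def atLeast0LessThan sum_distrib_left mult_ac)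
  finally show ?thesis .
qed

lemma cscalar_prod_hermitian:
  fixes A :: "complex mat"
  assumes "A \<in> carrier_mat n n" "hermitian_mat A" "v \<in> carrier_vec n" "w \<in> carrier_vec n"
  shows "(A *\<^sub>v v) \<bullet>c w = v \<bullet>c (A *\<^sub>v w)"
  using cscalar_prod_adjoint[of A n n v w] assms by (simp add: hermitian_mat_def)

lemma normalize_vec:
  fixes v :: "complex vec"
  assumes v: "v \<in> carrier_vec n" and "v \<noteq> 0\<^sub>v n"
  obtains c :: real where "(of_real c \<cdot>\<^sub>v v) \<bullet>c (of_real c \<cdot>\<^sub>v v) = 1"
proof -
  have pos: "0 < Re (v \<bullet>c v)" by (rule cscalar_prod_self_pos[OF assms])
  define q where "q = Re (v \<bullet>c v)"
  have q: "v \<bullet>c v = of_real q" using cscalar_prod_self[OF v] by (simp add: q_def)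
  have "1 / sqrt q * (1 / sqrt q * q) = 1" using pos by (simp add: q_def[symmetric])
  then have "complex_of_real (1 / sqrt q) * (of_real (1 / sqrt q) * of_real q) = 1"
    by (metis of_real_1 of_real_mult)
  then have "(of_real (1 / sqrt q) \<cdot>\<^sub>v v) \<bullet>c (of_real (1 / sqrt q) \<cdot>\<^sub>v v) = 1"
    using v by (simp add: cscalar_prod_smult_left cscalar_prod_smult_right q del: of_real_divide)
  then show ?thesis by (rule that)
qed

text \<open>Defined by coordinates, not by \<open>finsum_vec\<close>, so that the dimension is right
  for every \<open>g\<close> and sums can be interchanged directly.\<close>

definition lcomb :: "nat \<Rightarrow> nat \<Rightarrow> (nat \<Rightarrow> complex) \<Rightarrow> (nat \<Rightarrow> complex vec) \<Rightarrow> complex vec" where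
  "lcomb n k c g = vec n (\<lambda>r. \<Sum>i<k. c i * g i $ r)"

lemma lcomb_carrier [simp, intro]: "lcomb n k c g \<in> carrier_vec n"
  by (simp add: lcomb_def)

lemma cscalar_prod_lcomb:
  assumes "\<And>i. i < k \<Longrightarrow> g i \<in> carrier_vec n" "w \<in> carrier_vec n"
  shows "lcomb n k c g \<bullet>c w = (\<Sum>i<k. c i * (g i \<bullet>c w))"
proof -
  have "lcomb n k c g \<bullet>c w = (\<Sum>r<n. \<Sum>i<k. c i * g i $ r * cnj (w $ r))"
    unfolding cscalar_prod_eq_sum[OF lcomb_carrier assms(2)]
    by (simp add: lcomb_def sum_distrib_right)
  also have "\<dots> = (\<Sum>i<k. \<Sum>r<n. c i * g i $ r * cnj (w $ r))" by (rule sum.swap)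
  also have "\<dots> = (\<Sum>i<k. c i * (g i \<bullet>c w))"
  proof (intro sum.cong refl)
    fix i assume "i \<in> {..<k}"
    then show "(\<Sum>r<n. c i * g i $ r * cnj (w $ r)) = c i * (g i \<bullet>c w)"
      using assms by (simp add: cscalar_prod_eq_sum[of _ n] sum_distrib_left mult_ac)
  qed
  finally show ?thesis .
qed

lemma mult_mat_lcomb:
  assumes A: "A \<in> carrier_mat p n" and g: "\<And>i. i < k \<Longrightarrow> g i \<in> carrier_vec n"
  shows "A *\<^sub>v lcomb n k c g = lcomb p k c (\<lambda>i. A *\<^sub>v g i)"
proof (rule eq_vecI)
  fix r assume "r < dim_vec (lcomb p k c (\<lambda>i. A *\<^sub>v g i))"
  then have r: "r < p" by (simp add: lcomb_def)
  have "(A *\<^sub>v lcomb n k c g) $ r = (\<Sum>s<n. \<Sum>i<k. A $$ (r, s) * (c i * g i $ s))"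
    using A r by (simp add: scalar_prod_def lcomb_def atLeast0LessThan sum_distrib_left)
  also have "\<dots> = (\<Sum>i<k. \<Sum>s<n. A $$ (r, s) * (c i * g i $ s))" by (rule sum.swap)
  also have "\<dots> = (\<Sum>i<k. c i * (A *\<^sub>v g i) $ r)"
  proof (intro sum.cong refl)
    fix i assume "i \<in> {..<k}"
    then have "g i \<in> carrier_vec n" using g by simp
    then show "(\<Sum>s<n. A $$ (r, s) * (c i * g i $ s)) = c i * (A *\<^sub>v g i) $ r"
      using A r by (simp add: scalar_prod_def atLeast0LessThan sum_distrib_left mult_ac)
  qed
  finally show "(A *\<^sub>v lcomb n k c g) $ r = lcomb p k c (\<lambda>i. A *\<^sub>v g i) $ r"
    using r by (simp add: lcomb_def)
qed (use A in \<open>simp add: lcomb_def\<close>)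

lemma lcomb_cong:
  assumes "\<And>i. i < k \<Longrightarrow> c i = c' i" "\<And>i. i < k \<Longrightarrow> g i = g' i"
  shows "lcomb n k c g = lcomb n k c' g'"
  using assms by (auto simp: lcomb_def intro!: sum.cong)

text \<open>The conditions are the rows of a square matrix padded with zero rows. Row
  \<open>length ws\<close> is zero, so the transpose kills a unit vector and the determinant
  vanishes. This supplies the dimension counts for extending orthonormal families, for Weyl's
  inequality and for the rank of a frame.\<close>

lemma exists_orthogonal_vec:
  fixes ws :: "complex vec list"
  assumes ws: "set ws \<subseteq> carrier_vec n" and len: "length ws < n"
  shows "\<exists>z\<in>carrier_vec n. z \<noteq> 0\<^sub>v n \<and> (\<forall>w\<in>set ws. z \<bullet>c w = 0)"
proof -
  define A where "A = mat n n (\<lambda>(i, j). if i < length ws then cnj (ws ! i $ j) else 0)"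
  have A: "A \<in> carrier_mat n n" by (simp add: A_def)
  have "transpose_mat A *\<^sub>v unit_vec n (length ws) = 0\<^sub>v n"
    using len by (intro eq_vecI) (auto simp: A_def scalar_prod_def intro!: sum.neutral)
  moreover have "unit_vec n (length ws) \<noteq> (0\<^sub>v n :: complex vec)"
    using len by (metis index_unit_vec(1) index_zero_vec(1) zero_neq_one)
  ultimately have "det (transpose_mat A) = 0"
    using det_0_iff_vec_prod_zero[of "transpose_mat A" n] A unit_vec_carrier
    by (metis transpose_carrier_mat)
  then have "det A = 0" using det_transpose[OF A] by simp
  then obtain z where z: "z \<in> carrier_vec n" "z \<noteq> 0\<^sub>v n" "A *\<^sub>v z = 0\<^sub>v n"
    using det_0_iff_vec_prod_zero[OF A] by auto
  have "z \<bullet>c (ws ! i) = 0" if i: "i < length ws" for i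
  proof -
    have c: "ws ! i \<in> carrier_vec n" using ws i nth_mem by blast
    have "(A *\<^sub>v z) $ i = 0" using z(3) i len by simp
    then show ?thesis using z(1) c i len
      by (simp add: A_def cscalar_prod_eq_sum scalar_prod_def atLeast0LessThan mult.commute)
  qed
  then show ?thesis using z by (metis in_set_conv_nth)
qed

text \<open>Families are functions on all naturals of which only the first \<open>k\<close> values
  count; one-point updates and reindexing by permutations then stay within the same type.\<close>

definition orthonormal :: "nat \<Rightarrow> nat \<Rightarrow> (nat \<Rightarrow> complex vec) \<Rightarrow> bool" where
  "orthonormal n k g \<longleftrightarrow> (\<forall>i<k. g i \<in> carrier_vec n) \<and>
     (\<forall>i<k. \<forall>j<k. g i \<bullet>c g j = (if i = j then 1 else 0))"

abbreviation onb :: "nat \<Rightarrow> (nat \<Rightarrow> complex vec) \<Rightarrow> bool" where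
  "onb n g \<equiv> orthonormal n n g"

lemma orthonormal_carrier: "orthonormal n k g \<Longrightarrow> i < k \<Longrightarrow> g i \<in> carrier_vec n"
  by (simp add: orthonormal_def)

lemma orthonormal_prod:
  "orthonormal n k g \<Longrightarrow> i < k \<Longrightarrow> j < k \<Longrightarrow> g i \<bullet>c g j = (if i = j then 1 else 0)"
  by (simp add: orthonormal_def)

text \<open>The basis vectors are the columns of a square \<open>U\<close>, for which a left inverse
  is also a right inverse; \<open>U * mat_adjoint U = 1\<close> read entrywise is the resolution of
  the identity.\<close>

lemma onb_complete:
  assumes g: "onb n g" and r: "r < n" and s: "s < n"
  shows "(\<Sum>i<n. g i $ r * cnj (g i $ s)) = (if r = s then 1 else 0)"
proof -
  define U where "U = mat n n (\<lambda>(i, j). g j $ i)"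
  have U: "U \<in> carrier_mat n n" by (simp add: U_def)
  have "mat_adjoint U * U = 1\<^sub>m n"
  proof (rule eq_matI)
    fix i j assume "i < dim_row (1\<^sub>m n :: complex mat)" "j < dim_col (1\<^sub>m n :: complex mat)"
    then have ij: "i < n" "j < n" by auto
    have "(mat_adjoint U * U) $$ (i, j) = g j \<bullet>c g i"
      using ij cscalar_prod_eq_sum[OF orthonormal_carrier[OF g ij(2)] orthonormal_carrier[OF g ij(1)]]
      by (simp add: U_def scalar_prod_def atLeast0LessThan mult.commute)
    then show "(mat_adjoint U * U) $$ (i, j) = 1\<^sub>m n $$ (i, j)"
      using orthonormal_prod[OF g ij(2,1)] ij by auto
  qed (use U in auto)
  then have "U * mat_adjoint U = 1\<^sub>m n"
    using mat_mult_left_right_inverse[OF mat_adjoint_carrier[OF U] U] by simp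
  then have "(U * mat_adjoint U) $$ (r, s) = (if r = s then 1 else 0)" using r s by simp
  then show ?thesis using r s by (simp add: U_def scalar_prod_def atLeast0LessThan)
qed

lemma onb_expansion:
  assumes g: "onb n g" and v: "v \<in> carrier_vec n"
  shows "lcomb n n (\<lambda>i. v \<bullet>c g i) g = v"
proof (rule eq_vecI)
  fix r assume "r < dim_vec v"
  then have r: "r < n" using v by simp
  have "lcomb n n (\<lambda>i. v \<bullet>c g i) g $ r = (\<Sum>i<n. \<Sum>s<n. v $ s * (g i $ r * cnj (g i $ s)))"
    using r orthonormal_carrier[OF g]
    by (simp add: lcomb_def cscalar_prod_eq_sum[OF v] sum_distrib_left mult_ac)
  also have "\<dots> = (\<Sum>s<n. v $ s * (\<Sum>i<n. g i $ r * cnj (g i $ s)))"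
    by (subst sum.swap) (simp add: sum_distrib_left)
  also have "\<dots> = (\<Sum>s<n. if s = r then v $ s else 0)"
    using onb_complete[OF g r] by (intro sum.cong) auto
  finally show "lcomb n n (\<lambda>i. v \<bullet>c g i) g $ r = v $ r" using r by simp
qed (use v in \<open>simp add: lcomb_def\<close>)

lemma onb_parseval:
  assumes g: "onb n g" and v: "v \<in> carrier_vec n" and w: "w \<in> carrier_vec n"
  shows "v \<bullet>c w = (\<Sum>i<n. (v \<bullet>c g i) * (g i \<bullet>c w))"
  by (subst onb_expansion[OF g v, symmetric])
    (use orthonormal_carrier[OF g] w in \<open>simp add: cscalar_prod_lcomb\<close>)

lemma onb_vec_eqI:
  assumes g: "onb n g" and v: "v \<in> carrier_vec n" and w: "w \<in> carrier_vec n"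
    and "\<And>i. i < n \<Longrightarrow> v \<bullet>c g i = w \<bullet>c g i"
  shows "v = w"
proof -
  have "lcomb n n (\<lambda>i. v \<bullet>c g i) g = lcomb n n (\<lambda>i. w \<bullet>c g i) g"
    using assms(4) by (intro lcomb_cong) auto
  then show ?thesis using onb_expansion[OF g] v w by simp
qed

lemma onb_norm:
  assumes g: "onb n g" and v: "v \<in> carrier_vec n"
  shows "Re (v \<bullet>c v) = (\<Sum>i<n. (cmod (v \<bullet>c g i))\<^sup>2)"
proof -
  have "(v \<bullet>c g i) * (g i \<bullet>c v) = of_real ((cmod (v \<bullet>c g i))\<^sup>2)" if "i < n" for i
    using cnj_cscalar_prod[OF v orthonormal_carrier[OF g that]]
    by (simp add: complex_norm_square del: of_real_power)
  then have "v \<bullet>c v = of_real (\<Sum>i<n. (cmod (v \<bullet>c g i))\<^sup>2)"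
    by (subst onb_parseval[OF g v v]) simp
  then show ?thesis by simp
qed

lemma mat_eqI_onb:
  assumes g: "onb n g" and A: "A \<in> carrier_mat p n" and B: "B \<in> carrier_mat p n"
    and eq: "\<And>i. i < n \<Longrightarrow> A *\<^sub>v g i = B *\<^sub>v g i"
  shows "A = B"
proof (rule mat_col_eqI)
  fix j assume "j < dim_col B"
  then have j: "j < n" using B by simp
  have e: "unit_vec n j \<in> carrier_vec n" by simp
  have "A *\<^sub>v lcomb n n c g = B *\<^sub>v lcomb n n c g" for c
    using mult_mat_lcomb[OF A orthonormal_carrier[OF g]] mult_mat_lcomb[OF B orthonormal_carrier[OF g]]
      lcomb_cong[of n c c "\<lambda>i. A *\<^sub>v g i" "\<lambda>i. B *\<^sub>v g i" p] eq by simp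
  then have "A *\<^sub>v unit_vec n j = B *\<^sub>v unit_vec n j"
    using onb_expansion[OF g e] by metis
  moreover have "C *\<^sub>v unit_vec n j = col C j" if "C \<in> carrier_mat p n" for C :: "complex mat"
    using that j by (intro eq_vecI) auto
  ultimately show "col A j = col B j" using A B by metis
qed (use A B in auto)

text \<open>The missing vectors are added one at a time, by induction on \<open>n - k\<close>: any
  normalized vector orthogonal to the first \<open>k\<close> serves.\<close>

lemma orthonormal_extend:
  assumes "orthonormal n k g" "k \<le> n"
  shows "\<exists>h. onb n h \<and> (\<forall>i<k. h i = g i)"
  using assms
proof (induction "n - k" arbitrary: k g)
  case 0
  then show ?case by auto
next
  case (Suc d)
  then have k: "k < n" by simp
  have gc: "\<And>i. i < k \<Longrightarrow> g i \<in> carrier_vec n" using Suc.prems orthonormal_carrier by blast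
  obtain z where z: "z \<in> carrier_vec n" "z \<noteq> 0\<^sub>v n" "\<And>i. i < k \<Longrightarrow> z \<bullet>c g i = 0"
    using exists_orthogonal_vec[of "map g [0..<k]" n] k gc by (auto simp: image_subset_iff)
  obtain c where c: "(of_real c \<cdot>\<^sub>v z) \<bullet>c (of_real c \<cdot>\<^sub>v z) = 1"
    using normalize_vec[OF z(1,2)] .
  define u where "u = of_real c \<cdot>\<^sub>v z"
  have u: "u \<in> carrier_vec n" using z by (simp add: u_def)
  have uu: "u \<bullet>c u = 1" using c by (simp add: u_def)
  have ug: "u \<bullet>c g i = 0" if "i < k" for i
    using z gc that by (simp add: u_def cscalar_prod_smult_left)
  have gu: "g i \<bullet>c u = 0" if "i < k" for i
    using cnj_cscalar_prod[OF u gc[OF that]] ug[OF that] by simp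
  have "orthonormal n (Suc k) (g(k := u))"
    using Suc.prems(1) u uu ug gu unfolding orthonormal_def by (auto simp: less_Suc_eq)
  moreover have "d = n - Suc k" "Suc k \<le> n" using Suc.hyps(2) k by auto
  ultimately obtain h where "onb n h" "\<And>i. i < Suc k \<Longrightarrow> h i = (g(k := u)) i"
    using Suc.hyps(1)[of "Suc k" "g(k := u)"] by blast
  then show ?case by (intro exI[of _ h]) (auto simp: less_Suc_eq)
qed

section \<open>Orthonormal eigenbases of Hermitian matrices\<close>

definition eigsys :: "nat \<Rightarrow> complex mat \<Rightarrow> (nat \<Rightarrow> complex vec) \<Rightarrow> (nat \<Rightarrow> real) \<Rightarrow> bool" where
  "eigsys n A g a \<longleftrightarrow> onb n g \<and> (\<forall>i<n. A *\<^sub>v g i = of_real (a i) \<cdot>\<^sub>v g i)"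

text \<open>The orthogonal complement of the eigenvectors already found is invariant under a
  Hermitian matrix, so an eigenvector of the compression to it is an eigenvector of
  \<open>A\<close>.\<close>

lemma hermitian_orthonormal_eigenvectors:
  assumes A: "A \<in> carrier_mat n n" and h: "hermitian_mat A" and "k \<le> n"
  shows "\<exists>g a. orthonormal n k g \<and> (\<forall>i<k. A *\<^sub>v g i = of_real (a i) \<cdot>\<^sub>v g i)"
  using \<open>k \<le> n\<close>
proof (induction k)
  case 0
  then show ?case by (simp add: orthonormal_def)
next
  case (Suc k)
  then obtain g :: "nat \<Rightarrow> complex vec" and a :: "nat \<Rightarrow> real" where
    g: "orthonormal n k g" and ga: "\<And>i. i < k \<Longrightarrow> A *\<^sub>v g i = of_real (a i) \<cdot>\<^sub>v g i"
    by (meson Suc_leD)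
  obtain b where b: "onb n b" and bg: "\<And>i. i < k \<Longrightarrow> b i = g i"
    using orthonormal_extend[OF g] Suc.prems by auto
  have bc: "\<And>i. i < n \<Longrightarrow> b i \<in> carrier_vec n" using orthonormal_carrier[OF b] .
  have Ab: "\<And>i. i < n \<Longrightarrow> A *\<^sub>v b i \<in> carrier_vec n" using bc A by simp
  define l where "l = n - k"
  \<comment> \<open>The matrix of the compression of \<open>A\<close> to the span of the basis
    vectors from index \<open>k\<close> on; its eigenvector \<open>c\<close> lists the coordinates
    of \<open>v\<close> there.\<close>
  define C where "C = mat l l (\<lambda>(i, j). (A *\<^sub>v b (k + j)) \<bullet>c b (k + i))"
  have C: "C \<in> carrier_mat l l" by (simp add: C_def)
  have "spectrum C \<noteq> {}" using spectrum_non_empty[OF C] Suc.prems by (simp add: l_def)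
  then obtain e c where c: "c \<in> carrier_vec l" "c \<noteq> 0\<^sub>v l" "C *\<^sub>v c = e \<cdot>\<^sub>v c"
    using C unfolding spectrum_def eigenvalue_def eigenvector_def by auto
  define v where "v = lcomb n l (\<lambda>j. c $ j) (\<lambda>j. b (k + j))"
  have v: "v \<in> carrier_vec n" by (simp add: v_def)
  have bk: "b (k + j) \<in> carrier_vec n" if "j < l" for j using bc that by (simp add: l_def)
  have Av: "A *\<^sub>v v = lcomb n l (\<lambda>j. c $ j) (\<lambda>j. A *\<^sub>v b (k + j))"
    unfolding v_def by (rule mult_mat_lcomb[OF A bk])
  have vb: "v \<bullet>c b i = (if i < k then 0 else c $ (i - k))" if i: "i < n" for i
  proof -
    have "v \<bullet>c b i = (\<Sum>j<l. c $ j * (b (k + j) \<bullet>c b i))"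
      unfolding v_def using bk bc[OF i] by (rule cscalar_prod_lcomb)
    also have "\<dots> = (\<Sum>j<l. if k + j = i then c $ j else 0)"
      using i orthonormal_prod[OF b] by (intro sum.cong) (auto simp: l_def)
    also have "\<dots> = (if i < k then 0 else c $ (i - k))"
    proof (cases "i < k")
      case True
      then show ?thesis by (auto intro: sum.neutral)
    next
      case False
      then have "(\<Sum>j<l. if k + j = i then c $ j else 0) = (\<Sum>j<l. if j = i - k then c $ j else 0)"
        by (intro sum.cong) auto
      then show ?thesis using False i by (simp add: l_def)
    qed
    finally show ?thesis .
  qed
  \<comment> \<open>Coordinates are compared in \<open>b\<close>. Below \<open>k\<close> both
    vanish, as hermiticity moves \<open>A\<close> onto an eigenvector orthogonal to
    \<open>v\<close>; from \<open>k\<close> on they are the entries of \<open>C\<close> applied to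
    \<open>c\<close>.\<close>
  have "A *\<^sub>v v = e \<cdot>\<^sub>v v"
  proof (rule onb_vec_eqI[OF b])
    fix i assume i: "i < n"
    show "(A *\<^sub>v v) \<bullet>c b i = (e \<cdot>\<^sub>v v) \<bullet>c b i"
    proof (cases "i < k")
      case True
      have "(A *\<^sub>v v) \<bullet>c b i = v \<bullet>c (of_real (a i) \<cdot>\<^sub>v b i)"
        using cscalar_prod_hermitian[OF A h v bc[OF i]] ga[OF True] bg[OF True] by simp
      then show ?thesis using vb[OF i] True v bc[OF i]
        by (simp add: cscalar_prod_smult_left cscalar_prod_smult_right)
    next
      case False
      then have il: "i - k < l" using i by (simp add: l_def)
      have "(A *\<^sub>v v) \<bullet>c b i = (\<Sum>j<l. c $ j * ((A *\<^sub>v b (k + j)) \<bullet>c b i))"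
        unfolding Av using bk A bc[OF i] by (intro cscalar_prod_lcomb) auto
      also have "\<dots> = (C *\<^sub>v c) $ (i - k)"
        using c(1) il False by (simp add: C_def scalar_prod_def atLeast0LessThan mult.commute)
      also have "\<dots> = e * c $ (i - k)" using c il by simp
      finally show ?thesis using vb[OF i] False v bc[OF i] by (simp add: cscalar_prod_smult_left)
    qed
  qed (use v A in auto)
  moreover have vnz: "v \<noteq> 0\<^sub>v n"
  proof
    assume v0: "v = 0\<^sub>v n"
    have "c $ i = 0" if "i < l" for i
    proof -
      have "k + i < n" using that by (simp add: l_def)
      then have "v \<bullet>c b (k + i) = c $ i" using vb by simp
      then show ?thesis using v0 bk[OF that] by (simp add: cscalar_prod_eq_sum)
    qed
    then have "c = 0\<^sub>v l" using c(1) by (intro eq_vecI) auto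
    then show False using c(2) by simp
  qed
  ultimately have "eigenvalue A e"
    using v A unfolding eigenvalue_def eigenvector_def by auto
  then have "e \<in> \<real>" by (rule hermitian_eigenvalue_real[OF A h])
  then obtain t where t: "e = of_real t" by (auto elim: Reals_cases)
  obtain r where r: "(of_real r \<cdot>\<^sub>v v) \<bullet>c (of_real r \<cdot>\<^sub>v v) = 1"
    using normalize_vec[OF v vnz] .
  define u where "u = of_real r \<cdot>\<^sub>v v"
  have u: "u \<in> carrier_vec n" using v by (simp add: u_def)
  have uu: "u \<bullet>c u = 1" using r by (simp add: u_def)
  have ug: "u \<bullet>c g i = 0" if "i < k" for i
    using vb[of i] that Suc.prems v bc[of i] bg[OF that] by (simp add: u_def cscalar_prod_smult_left)
  have gu: "g i \<bullet>c u = 0" if "i < k" for i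
    using cnj_cscalar_prod[OF u orthonormal_carrier[OF g that]] ug[OF that] by simp
  have "orthonormal n (Suc k) (g(k := u))"
    using g u uu ug gu unfolding orthonormal_def by (auto simp: less_Suc_eq)
  moreover have "A *\<^sub>v u = of_real t \<cdot>\<^sub>v u"
    using \<open>A *\<^sub>v v = e \<cdot>\<^sub>v v\<close> t A v
    by (simp add: u_def mult_mat_vec smult_smult_assoc mult.commute)
  ultimately show ?case
    using ga by (intro exI[of _ "g(k := u)"] exI[of _ "a(k := t)"] conjI)
      (auto simp: less_Suc_eq simp del: fun_upd_apply, auto)
qed

definition desc :: "nat \<Rightarrow> (nat \<Rightarrow> real) \<Rightarrow> bool" where
  "desc n a \<longleftrightarrow> (\<forall>i j. i \<le> j \<longrightarrow> j < n \<longrightarrow> a j \<le> a i)"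

lemma descD: "desc n a \<Longrightarrow> i \<le> j \<Longrightarrow> j < n \<Longrightarrow> a j \<le> a i"
  by (simp add: desc_def)

lemma desc_sorted_nth: "sorted_wrt (\<ge>) xs \<Longrightarrow> desc (length xs) (\<lambda>i. xs ! i)"
  unfolding desc_def by (metis le_eq_less_or_eq order_refl sorted_wrt_iff_nth_less)

text \<open>Turns a condition inherited by smaller indices, such as positivity or being at least 1
  along a non-increasing sequence, into a cut at one index.\<close>

lemma downward_closed_threshold:
  assumes "\<And>i j. i \<le> j \<Longrightarrow> j < n \<Longrightarrow> P j \<Longrightarrow> P i"
  obtains k :: nat where "k \<le> n" "\<And>i. i < n \<Longrightarrow> P i \<longleftrightarrow> i < k"
proof -
  have "\<exists>k\<le>n. \<forall>i<n. P i \<longleftrightarrow> i < k"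
    using assms
  proof (induction n)
    case 0
    then show ?case by simp
  next
    case (Suc n)
    then obtain k where k: "k \<le> n" "\<And>i. i < n \<Longrightarrow> P i \<longleftrightarrow> i < k" by (metis less_SucI)
    show ?case
    proof (cases "P n")
      case True
      then show ?thesis using Suc.prems[of _ n] by (intro exI[of _ "Suc n"]) auto
    next
      case False
      then show ?thesis using k by (intro exI[of _ k]) (auto simp: less_Suc_eq)
    qed
  qed
  then show ?thesis using that by blast
qed

section \<open>Unitary diagonalization\<close>

definition real_diag :: "nat \<Rightarrow> (nat \<Rightarrow> real) \<Rightarrow> complex mat" where
  "real_diag n x = mat n n (\<lambda>(i, j). if i = j then of_real (x i) else 0)"

definition onb_mat :: "nat \<Rightarrow> (nat \<Rightarrow> complex vec) \<Rightarrow> complex mat" where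
  "onb_mat n g = mat n n (\<lambda>(i, j). g j $ i)"

lemma index_mult_mat_sum:
  assumes "A \<in> carrier_mat p q" "B \<in> carrier_mat q r" "i < p" "j < r"
  shows "(A * B) $$ (i, j) = (\<Sum>k<q. A $$ (i, k) * B $$ (k, j))"
  using assms by (auto simp: scalar_prod_def atLeast0LessThan intro!: sum.cong)

lemma real_diag_carrier [simp, intro]: "real_diag n x \<in> carrier_mat n n"
  by (simp add: real_diag_def)

lemma onb_mat_carrier [simp, intro]: "onb_mat n g \<in> carrier_mat n n"
  by (simp add: onb_mat_def)

lemma mat_adjoint_real_diag: "mat_adjoint (real_diag n x) = real_diag n x"
  by (rule eq_matI) (auto simp: real_diag_def)

lemma real_diag_mult_unit:
  "i < n \<Longrightarrow> real_diag n x *\<^sub>v unit_vec n i = of_real (x i) \<cdot>\<^sub>v unit_vec n i"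
  by (intro eq_vecI) (auto simp: real_diag_def)

lemma square_mult_carrier [simp, intro]:
  "A \<in> carrier_mat n n \<Longrightarrow> B \<in> carrier_mat n n \<Longrightarrow> A * B \<in> carrier_mat n n"
  by (rule mult_carrier_mat)

lemma onb_mat_mult_unit:
  assumes "onb n g" "i < n"
  shows "onb_mat n g *\<^sub>v unit_vec n i = g i"
  using orthonormal_carrier[OF assms] assms(2) by (intro eq_vecI) (auto simp: onb_mat_def)

lemma adjoint_onb_mat_mult:
  assumes "onb n g" "i < n"
  shows "mat_adjoint (onb_mat n g) *\<^sub>v g i = unit_vec n i"
proof (rule eq_vecI)
  fix j assume "j < dim_vec (unit_vec n i :: complex vec)"
  then have j: "j < n" by simp
  have "(mat_adjoint (onb_mat n g) *\<^sub>v g i) $ j = g i \<bullet>c g j"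
    using cscalar_prod_eq_sum[OF orthonormal_carrier[OF assms] orthonormal_carrier[OF assms(1) j]]
      orthonormal_carrier[OF assms] j
    by (simp add: onb_mat_def scalar_prod_def atLeast0LessThan mult.commute)
  then show "(mat_adjoint (onb_mat n g) *\<^sub>v g i) $ j = unit_vec n i $ j"
    using orthonormal_prod[OF assms j] assms(2) j by auto
qed (simp add: onb_mat_def)

lemma onb_unit_vec: "onb n (unit_vec n)"
  by (auto simp: orthonormal_def)

lemma unitary_onb_mat:
  assumes g: "onb n g"
  shows "unitary_mat n (onb_mat n g)"
proof -
  have c: "onb_mat n g \<in> carrier_mat n n" "mat_adjoint (onb_mat n g) \<in> carrier_mat n n" by auto
  have "mat_adjoint (onb_mat n g) * onb_mat n g = 1\<^sub>m n"
  proof (rule mat_eqI_onb[OF onb_unit_vec])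
    fix i assume i: "i < n"
    show "(mat_adjoint (onb_mat n g) * onb_mat n g) *\<^sub>v unit_vec n i = 1\<^sub>m n *\<^sub>v unit_vec n i"
      using assoc_mult_mat_vec[OF c(2,1), of "unit_vec n i"] onb_mat_mult_unit[OF g i]
        adjoint_onb_mat_mult[OF g i] by simp
  qed auto
  then show ?thesis
    unfolding unitary_mat_def using c mat_mult_left_right_inverse[OF c(2,1)] by blast
qed

lemma unitary_mat_adjoint: "unitary_mat n U \<Longrightarrow> unitary_mat n (mat_adjoint U)"
  by (auto simp: unitary_mat_def)

text \<open>With \<open>u = g\<close> this is the spectral decomposition, in general a singular
  value decomposition; \<open>s\<close> may have either sign, which also covers sign changes of a
  diagonal.\<close>

lemma decomposition_by_onbs:
  assumes u: "onb n u" and g: "onb n g" and A: "A \<in> carrier_mat n n"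
    and eq: "\<And>i. i < n \<Longrightarrow> A *\<^sub>v g i = of_real (s i) \<cdot>\<^sub>v u i"
  shows "A = onb_mat n u * real_diag n s * mat_adjoint (onb_mat n g)"
proof (rule mat_eqI_onb[OF g A])
  have c: "mat_adjoint (onb_mat n g) \<in> carrier_mat n n" by auto
  have c': "onb_mat n u * real_diag n s \<in> carrier_mat n n" by auto
  fix i assume i: "i < n"
  have "(onb_mat n u * real_diag n s * mat_adjoint (onb_mat n g)) *\<^sub>v g i
      = (onb_mat n u * real_diag n s) *\<^sub>v unit_vec n i"
    using assoc_mult_mat_vec[OF c' c orthonormal_carrier[OF g i]] adjoint_onb_mat_mult[OF g i] by simp
  also have "\<dots> = onb_mat n u *\<^sub>v (of_real (s i) \<cdot>\<^sub>v unit_vec n i)"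
    using i by (subst assoc_mult_mat_vec[of _ n n _ n]) (auto simp: real_diag_mult_unit)
  also have "\<dots> = of_real (s i) \<cdot>\<^sub>v u i"
    using i onb_mat_mult_unit[OF u i]
    by (subst mult_mat_vec[of _ n n]) auto
  finally show "A *\<^sub>v g i = (onb_mat n u * real_diag n s * mat_adjoint (onb_mat n g)) *\<^sub>v g i"
    using eq[OF i] by simp
qed auto

lemma eigsys_onb: "eigsys n A g a \<Longrightarrow> onb n g"
  by (simp add: eigsys_def)

lemma eigsys_mult: "eigsys n A g a \<Longrightarrow> i < n \<Longrightarrow> A *\<^sub>v g i = of_real (a i) \<cdot>\<^sub>v g i"
  by (simp add: eigsys_def)

lemma eigsys_decomposition:
  assumes "A \<in> carrier_mat n n" "eigsys n A g a"
  shows "A = onb_mat n g * real_diag n a * mat_adjoint (onb_mat n g)"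
  using decomposition_by_onbs[of n g g A a] assms by (simp add: eigsys_def)

lemma eigsys_hermitian:
  assumes A: "A \<in> carrier_mat n n" and e: "eigsys n A g a"
  shows "hermitian_mat A"
proof -
  have c: "onb_mat n g \<in> carrier_mat n n" "mat_adjoint (onb_mat n g) \<in> carrier_mat n n" by auto
  have "mat_adjoint (onb_mat n g * real_diag n a * mat_adjoint (onb_mat n g))
      = onb_mat n g * real_diag n a * mat_adjoint (onb_mat n g)"
    using c mat_adjoint_mult[of "onb_mat n g * real_diag n a" n n "mat_adjoint (onb_mat n g)" n]
      mat_adjoint_mult[of "onb_mat n g" n n "real_diag n a" n]
    by (simp add: mat_adjoint_real_diag assoc_mult_mat[of _ n n _ n _ n])
  then show ?thesis
    unfolding hermitian_mat_def using eigsys_decomposition[OF assms] by simp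
qed

lemma has_eigenvalues_eigsys:
  assumes A: "A \<in> carrier_mat n n" and e: "eigsys n A g a"
  shows "has_eigenvalues A (map a [0..<n])"
proof -
  have u: "unitary_mat n (onb_mat n g)" by (rule unitary_onb_mat[OF eigsys_onb[OF e]])
  have "similar_mat_wit A (real_diag n a) (onb_mat n g) (mat_adjoint (onb_mat n g))"
    using eigsys_decomposition[OF assms] u A by (intro similar_mat_witI[of _ _ n]) (auto simp: unitary_mat_def)
  then have "char_poly A = char_poly (real_diag n a)"
    by (intro char_poly_similar) (auto simp: similar_mat_def)
  also have "\<dots> = (\<Prod>x\<leftarrow>diag_mat (real_diag n a). [:- x, 1:])"
    by (rule char_poly_upper_triangular[of _ n]) (auto simp: real_diag_def)
  also have "diag_mat (real_diag n a) = map (\<lambda>i. complex_of_real (a i)) [0..<n]"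
    by (auto simp: diag_mat_def real_diag_def)
  finally show ?thesis by (simp add: has_eigenvalues_def o_def)
qed

lemma permutation_of_mset_eq:
  assumes "mset (map a [0..<n]) = mset (map b [0..<n])"
  obtains p where "p permutes {..<n}" "\<And>i. i < n \<Longrightarrow> b i = a (p i)"
proof -
  obtain p where p: "p permutes {..<length (map a [0..<n])}" "permute_list p (map a [0..<n]) = map b [0..<n]"
    using mset_eq_permutation[OF assms[symmetric]] by blast
  have "b i = a (p i)" if i: "i < n" for i
  proof -
    have "permute_list p (map a [0..<n]) ! i = map a [0..<n] ! p i"
      using permute_list_nth[OF p(1)] i by simp
    moreover have "p i < n" using p(1) i permutes_in_image[of p "{..<n}" i] by simp
    ultimately show ?thesis using p(2) i by simp
  qed
  then show ?thesis using that p(1) by simp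
qed

lemma onb_permute:
  assumes "onb n g" "p permutes {..<n}"
  shows "onb n (\<lambda>i. g (p i))"
proof -
  have "p i < n \<longleftrightarrow> i < n" for i using permutes_in_image[OF assms(2), of i] by simp
  moreover have "p i = p j \<longleftrightarrow> i = j" for i j using permutes_inj[OF assms(2)] by (auto dest: injD)
  ultimately show ?thesis using assms(1) by (simp add: orthonormal_def)
qed

text \<open>Uniqueness of the spectrum as a multiset makes \<open>b\<close> a rearrangement of the
  eigenvalues of some orthonormal eigenbasis, and permuting that basis realizes the prescribed
  order.\<close>

lemma spectral_theorem:
  assumes A: "A \<in> carrier_mat n n" and h: "hermitian_mat A"
    and b: "has_eigenvalues A (map b [0..<n])"
  shows "\<exists>g. eigsys n A g b"
proof -
  obtain g a where ga: "eigsys n A g a"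
    using hermitian_orthonormal_eigenvectors[OF A h, of n] by (auto simp: eigsys_def)
  have "mset (map a [0..<n]) = mset (map b [0..<n])"
    using has_eigenvalues_unique[OF has_eigenvalues_eigsys[OF A ga] b] .
  then obtain p where p: "p permutes {..<n}" "\<And>i. i < n \<Longrightarrow> b i = a (p i)"
    using permutation_of_mset_eq by blast
  have "p i < n" if "i < n" for i using permutes_in_image[OF p(1), of i] that by simp
  then have "eigsys n A (\<lambda>i. g (p i)) b"
    using ga p(2) onb_permute[OF _ p(1)] by (simp add: eigsys_def)
  then show ?thesis by blast
qed

lemma spectral_theorem_desc:
  assumes A: "A \<in> carrier_mat n n" and h: "hermitian_mat A"
  shows "\<exists>g. eigsys n A g (\<lambda>i. eigvals_desc A ! i)" "desc n (\<lambda>i. eigvals_desc A ! i)"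
proof -
  have "map (\<lambda>i. eigvals_desc A ! i) [0..<n] = eigvals_desc A"
    using eigvals_desc_hermitian(3)[OF A h] by (metis map_nth)
  then show "\<exists>g. eigsys n A g (\<lambda>i. eigvals_desc A ! i)"
    using spectral_theorem[OF A h, of "\<lambda>i. eigvals_desc A ! i"] eigvals_desc_hermitian(1)[OF A h] by simp
  show "desc n (\<lambda>i. eigvals_desc A ! i)"
    using desc_sorted_nth eigvals_desc_hermitian(2,3)[OF A h] by metis
qed

lemma eigsys_prod:
  assumes A: "A \<in> carrier_mat n n" and e: "eigsys n A g a"
    and v: "v \<in> carrier_vec n" and w: "w \<in> carrier_vec n"
  shows "(A *\<^sub>v v) \<bullet>c w = (\<Sum>i<n. of_real (a i) * ((v \<bullet>c g i) * (g i \<bullet>c w)))"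
proof -
  have gc: "\<And>i. i < n \<Longrightarrow> g i \<in> carrier_vec n" using orthonormal_carrier[OF eigsys_onb[OF e]] .
  have "A *\<^sub>v v = lcomb n n (\<lambda>i. v \<bullet>c g i) (\<lambda>i. A *\<^sub>v g i)"
    using mult_mat_lcomb[where g = g and k = n and c = "\<lambda>i. v \<bullet>c g i", OF A gc] onb_expansion[OF eigsys_onb[OF e] v] by simp
  also have "\<dots> \<bullet>c w = (\<Sum>i<n. (v \<bullet>c g i) * ((A *\<^sub>v g i) \<bullet>c w))"
    using A gc w by (intro cscalar_prod_lcomb) auto
  also have "\<dots> = (\<Sum>i<n. of_real (a i) * ((v \<bullet>c g i) * (g i \<bullet>c w)))"
    using gc w by (intro sum.cong) (auto simp: eigsys_mult[OF e] cscalar_prod_smult_left[of _ n])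
  finally show ?thesis .
qed

lemma eigsys_quadratic_form:
  assumes A: "A \<in> carrier_mat n n" and e: "eigsys n A g a" and v: "v \<in> carrier_vec n"
  shows "Re ((A *\<^sub>v v) \<bullet>c v) = (\<Sum>i<n. a i * (cmod (v \<bullet>c g i))\<^sup>2)"
proof -
  have "(v \<bullet>c g i) * (g i \<bullet>c v) = of_real ((cmod (v \<bullet>c g i))\<^sup>2)" if "i < n" for i
    using cnj_cscalar_prod[OF v orthonormal_carrier[OF eigsys_onb[OF e] that]]
    by (simp add: complex_norm_square del: of_real_power)
  then have "(A *\<^sub>v v) \<bullet>c v = (\<Sum>i<n. of_real (a i) * of_real ((cmod (v \<bullet>c g i))\<^sup>2))"
    unfolding eigsys_prod[OF A e v v] by (intro sum.cong) auto
  also have "\<dots> = of_real (\<Sum>i<n. a i * (cmod (v \<bullet>c g i))\<^sup>2)" by simp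
  finally show ?thesis by (simp only: Re_complex_of_real)
qed

text \<open>Functional calculus: a matrix is rebuilt from the eigenbasis \<open>g\<close> with new
  eigenvalues \<open>f\<close>. It provides the positive part in Lidskii's inequality.\<close>

definition spectral_mat :: "nat \<Rightarrow> (nat \<Rightarrow> complex vec) \<Rightarrow> (nat \<Rightarrow> real) \<Rightarrow> complex mat" where
  "spectral_mat n g f = onb_mat n g * real_diag n f * mat_adjoint (onb_mat n g)"

lemma spectral_mat_carrier [simp, intro]: "spectral_mat n g f \<in> carrier_mat n n"
  by (auto simp: spectral_mat_def)

lemma index_spectral_mat:
  assumes "onb n g" "r < n" "s < n"
  shows "spectral_mat n g f $$ (r, s) = (\<Sum>i<n. of_real (f i) * (g i $ r * cnj (g i $ s)))"
proof -
  have cd: "(onb_mat n g * real_diag n f) $$ (r, i) = g i $ r * of_real (f i)" if i: "i < n" for i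
  proof -
    have "(onb_mat n g * real_diag n f) $$ (r, i)
        = (\<Sum>j<n. onb_mat n g $$ (r, j) * real_diag n f $$ (j, i))"
      using assms(2) i by (intro index_mult_mat_sum) auto
    also have "\<dots> = (\<Sum>j<n. if j = i then g j $ r * of_real (f j) else 0)"
      using assms(2) i by (intro sum.cong) (auto simp: onb_mat_def real_diag_def)
    finally show ?thesis using i by simp
  qed
  have "spectral_mat n g f $$ (r, s)
      = (\<Sum>i<n. (onb_mat n g * real_diag n f) $$ (r, i) * mat_adjoint (onb_mat n g) $$ (i, s))"
    unfolding spectral_mat_def using assms(2,3) by (intro index_mult_mat_sum) auto
  also have "\<dots> = (\<Sum>i<n. of_real (f i) * (g i $ r * cnj (g i $ s)))"
    using assms(3) by (intro sum.cong) (simp_all add: cd, simp add: onb_mat_def)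
  finally show ?thesis .
qed

lemma eigsys_spectral_mat:
  assumes g: "onb n g"
  shows "eigsys n (spectral_mat n g f) g f"
  unfolding eigsys_def
proof (intro conjI g allI impI)
  fix i assume i: "i < n"
  have c: "mat_adjoint (onb_mat n g) \<in> carrier_mat n n" by auto
  have c': "onb_mat n g * real_diag n f \<in> carrier_mat n n" by auto
  have "spectral_mat n g f *\<^sub>v g i = (onb_mat n g * real_diag n f) *\<^sub>v unit_vec n i"
    unfolding spectral_mat_def
    using assoc_mult_mat_vec[OF c' c orthonormal_carrier[OF g i]] adjoint_onb_mat_mult[OF g i] by simp
  also have "\<dots> = onb_mat n g *\<^sub>v (of_real (f i) \<cdot>\<^sub>v unit_vec n i)"
    using i by (subst assoc_mult_mat_vec[of _ n n _ n]) (auto simp: real_diag_mult_unit)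
  also have "\<dots> = of_real (f i) \<cdot>\<^sub>v g i"
    using i onb_mat_mult_unit[OF g i]
    by (subst mult_mat_vec[of _ n n]) auto
  finally show "spectral_mat n g f *\<^sub>v g i = of_real (f i) \<cdot>\<^sub>v g i" .
qed

text \<open>Each basis vector contributes its eigenvalue times its squared norm 1. Comparing traces
  is what turns inequalities between single eigenvalues into a bound on sums.\<close>

lemma eigsys_trace:
  assumes A: "A \<in> carrier_mat n n" and e: "eigsys n A g a"
  shows "(\<Sum>r<n. A $$ (r, r)) = of_real (\<Sum>i<n. a i)"
proof -
  have g: "onb n g" by (rule eigsys_onb[OF e])
  have "A = spectral_mat n g a" using eigsys_decomposition[OF A e] by (simp add: spectral_mat_def)
  then have "(\<Sum>r<n. A $$ (r, r)) = (\<Sum>r<n. \<Sum>i<n. of_real (a i) * (g i $ r * cnj (g i $ r)))"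
    using index_spectral_mat[OF g] by simp
  also have "\<dots> = (\<Sum>i<n. of_real (a i) * (\<Sum>r<n. g i $ r * cnj (g i $ r)))"
    by (subst sum.swap) (simp add: sum_distrib_left)
  also have "\<dots> = (\<Sum>i<n. of_real (a i))"
  proof (intro sum.cong refl)
    fix i assume "i \<in> {..<n}"
    then have i: "i < n" by simp
    show "of_real (a i) * (\<Sum>r<n. g i $ r * cnj (g i $ r)) = complex_of_real (a i)"
      using cscalar_prod_eq_sum[OF orthonormal_carrier[OF g i] orthonormal_carrier[OF g i]]
        orthonormal_prod[OF g i i] by simp
  qed
  finally show ?thesis by simp
qed

section \<open>Weyl's and Lidskii's inequalities\<close>

text \<open>By \<open>dim\<close> there is a nonzero \<open>z\<close> satisfying
  \<open>p - 1 - i\<close> orthogonality conditions on the side of \<open>S\<close> and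
  \<open>j\<close> on the side of \<open>T\<close>; there the form of \<open>A\<close> is at least
  \<open>a i\<close>, and that of \<open>B\<close> at most \<open>b j\<close>, times the squared
  norm. Two separate isometries make Weyl's monotonicity (both the identity) and Cauchy interlacing
  (one of them the adjoint of a coisometry) instances of one statement.\<close>

lemma weyl_inequality:
  assumes A: "A \<in> carrier_mat p p" and a: "eigsys p A g a" "desc p a"
    and B: "B \<in> carrier_mat q q" and b: "eigsys q B h b" "desc q b"
    and S: "S \<in> carrier_mat p r" and T: "T \<in> carrier_mat q r"
    and isoS: "\<And>z. z \<in> carrier_vec r \<Longrightarrow> Re ((S *\<^sub>v z) \<bullet>c (S *\<^sub>v z)) = Re (z \<bullet>c z)"
    and isoT: "\<And>z. z \<in> carrier_vec r \<Longrightarrow> Re ((T *\<^sub>v z) \<bullet>c (T *\<^sub>v z)) = Re (z \<bullet>c z)"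
    and le: "\<And>z. z \<in> carrier_vec r \<Longrightarrow> Re ((A *\<^sub>v (S *\<^sub>v z)) \<bullet>c (S *\<^sub>v z))
        \<le> Re ((B *\<^sub>v (T *\<^sub>v z)) \<bullet>c (T *\<^sub>v z)) + t * Re (z \<bullet>c z)"
    and i: "i < p" and j: "j < q" and dim: "p - 1 - i + j < r"
  shows "a i \<le> b j + t"
proof -
  have g: "onb p g" and h: "onb q h" using a b eigsys_onb by blast+
  let ?ws = "map (\<lambda>l. mat_adjoint S *\<^sub>v g l) [Suc i..<p] @ map (\<lambda>l. mat_adjoint T *\<^sub>v h l) [0..<j]"
  have sub: "set ?ws \<subseteq> carrier_vec r"
    using S T by (auto intro!: carrier_vecI)
  have "length ?ws < r" using dim i by simp
  then obtain z where z: "z \<in> carrier_vec r" "z \<noteq> 0\<^sub>v r" and orth: "\<And>w. w \<in> set ?ws \<Longrightarrow> z \<bullet>c w = 0"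
    using exists_orthogonal_vec[OF sub] by blast
  have Sz: "S *\<^sub>v z \<in> carrier_vec p" and Tz: "T *\<^sub>v z \<in> carrier_vec q" using S T z by auto
  have Sg: "(S *\<^sub>v z) \<bullet>c g l = 0" if l: "i < l" "l < p" for l
  proof -
    have "z \<bullet>c (mat_adjoint S *\<^sub>v g l) = 0" using l by (intro orth) auto
    then show ?thesis using cscalar_prod_adjoint[OF S z(1) orthonormal_carrier[OF g l(2)]] by simp
  qed
  have Th: "(T *\<^sub>v z) \<bullet>c h l = 0" if l: "l < j" for l
  proof -
    have lq: "l < q" using l j by simp
    have "z \<bullet>c (mat_adjoint T *\<^sub>v h l) = 0" using l by (intro orth) auto
    then show ?thesis using cscalar_prod_adjoint[OF T z(1) orthonormal_carrier[OF h lq]] by simp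
  qed
  have "a i * Re (z \<bullet>c z) = (\<Sum>l<p. a i * (cmod ((S *\<^sub>v z) \<bullet>c g l))\<^sup>2)"
    using onb_norm[OF g Sz] isoS[OF z(1)] by (simp add: sum_distrib_left)
  also have "\<dots> \<le> (\<Sum>l<p. a l * (cmod ((S *\<^sub>v z) \<bullet>c g l))\<^sup>2)"
  proof (rule sum_mono)
    fix l assume "l \<in> {..<p}"
    then show "a i * (cmod ((S *\<^sub>v z) \<bullet>c g l))\<^sup>2 \<le> a l * (cmod ((S *\<^sub>v z) \<bullet>c g l))\<^sup>2"
      using Sg[of l] descD[OF a(2), of l i] i
      by (cases "i < l") (auto intro!: mult_right_mono)
  qed
  also have "\<dots> = Re ((A *\<^sub>v (S *\<^sub>v z)) \<bullet>c (S *\<^sub>v z))"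
    by (simp add: eigsys_quadratic_form[OF A a(1) Sz])
  also have "\<dots> \<le> Re ((B *\<^sub>v (T *\<^sub>v z)) \<bullet>c (T *\<^sub>v z)) + t * Re (z \<bullet>c z)"
    by (rule le[OF z(1)])
  also have "Re ((B *\<^sub>v (T *\<^sub>v z)) \<bullet>c (T *\<^sub>v z)) = (\<Sum>l<q. b l * (cmod ((T *\<^sub>v z) \<bullet>c h l))\<^sup>2)"
    by (rule eigsys_quadratic_form[OF B b(1) Tz])
  also have "\<dots> \<le> (\<Sum>l<q. b j * (cmod ((T *\<^sub>v z) \<bullet>c h l))\<^sup>2)"
  proof (rule sum_mono)
    fix l assume "l \<in> {..<q}"
    then show "b l * (cmod ((T *\<^sub>v z) \<bullet>c h l))\<^sup>2 \<le> b j * (cmod ((T *\<^sub>v z) \<bullet>c h l))\<^sup>2"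
      using Th[of l] descD[OF b(2), of j l]
      by (cases "l < j") (auto intro!: mult_right_mono)
  qed
  also have "\<dots> = b j * Re (z \<bullet>c z)"
    using onb_norm[OF h Tz] isoT[OF z(1)] by (simp add: sum_distrib_left)
  finally have "a i * Re (z \<bullet>c z) \<le> (b j + t) * Re (z \<bullet>c z)" by (simp add: algebra_simps)
  then show ?thesis using cscalar_prod_self_pos[OF z] by simp
qed

text \<open>Both isometries are the identity; with equal indices the orthogonality conditions number
  \<open>n - 1\<close>, one fewer than the dimension.\<close>

lemma weyl_monotone:
  assumes A: "A \<in> carrier_mat n n" "eigsys n A g a" "desc n a"
    and B: "B \<in> carrier_mat n n" "eigsys n B h b" "desc n b"
    and le: "\<And>z. z \<in> carrier_vec n \<Longrightarrow>
      Re ((A *\<^sub>v z) \<bullet>c z) \<le> Re ((B *\<^sub>v z) \<bullet>c z) + t * Re (z \<bullet>c z)"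
    and i: "i < n"
  shows "a i \<le> b i + t"
proof (rule weyl_inequality[OF A B one_carrier_mat one_carrier_mat])
  fix z :: "complex vec" assume z: "z \<in> carrier_vec n"
  show "Re ((A *\<^sub>v (1\<^sub>m n *\<^sub>v z)) \<bullet>c (1\<^sub>m n *\<^sub>v z))
      \<le> Re ((B *\<^sub>v (1\<^sub>m n *\<^sub>v z)) \<bullet>c (1\<^sub>m n *\<^sub>v z)) + t * Re (z \<bullet>c z)"
    using le[OF z] z by simp
qed (use i in simp_all)

text \<open>The argument of Li and Mathias: let \<open>t\<close> be the \<open>k\<close>-th largest eigenvalue of \<open>C\<close>, where
  \<open>k = card J\<close>, and let \<open>G\<close> be the positive part of \<open>C - t\<close>. Then \<open>C \<le> t + G\<close>, so the
  eigenvalues of \<open>B + G\<close> dominate those of \<open>A - t\<close> and of \<open>B\<close>, and they exceed those of \<open>B\<close>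
  by \<open>tr G\<close> in total.\<close>

lemma lidskii:
  assumes A: "A \<in> carrier_mat n n" "eigsys n A g a" "desc n a"
    and B: "B \<in> carrier_mat n n" "eigsys n B h b" "desc n b"
    and C: "C \<in> carrier_mat n n" "eigsys n C e c" "desc n c"
    and ABC: "A = B + C" and J: "J \<subseteq> {..<n}"
  shows "(\<Sum>j\<in>J. a j - b j) \<le> (\<Sum>i<card J. c i)"
proof (cases "J = {}")
  case False
  define k where "k = card J"
  have finJ: "finite J" using J finite_subset by blast
  have k: "0 < k" "k \<le> n"
    using False finJ card_mono[OF finite_lessThan J] by (auto simp: k_def card_gt_0_iff)
  define t where "t = c (k - 1)"
  have e: "onb n e" using C eigsys_onb by blast
  define G where "G = spectral_mat n e (\<lambda>i. max (c i - t) 0)"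
  have G: "G \<in> carrier_mat n n" "eigsys n G e (\<lambda>i. max (c i - t) 0)"
    using eigsys_spectral_mat[OF e] by (auto simp: G_def)
  have BG: "B + G \<in> carrier_mat n n" using B G by auto
  have "hermitian_mat (B + G)"
  proof -
    have "hermitian_mat B" "hermitian_mat G"
      using eigsys_hermitian[OF B(1,2)] eigsys_hermitian[OF G] by auto
    moreover have "mat_adjoint (B + G) = mat_adjoint B + mat_adjoint G"
      using B(1) G(1) by (intro eq_matI) auto
    ultimately show ?thesis by (simp add: hermitian_mat_def)
  qed
  then obtain f d where d: "eigsys n (B + G) f d" "desc n d"
    using spectral_theorem_desc[OF BG] by blast
  have add_form: "Re (((M + N) *\<^sub>v z) \<bullet>c z) = Re ((M *\<^sub>v z) \<bullet>c z) + Re ((N *\<^sub>v z) \<bullet>c z)"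
    if "M \<in> carrier_mat n n" "N \<in> carrier_mat n n" "z \<in> carrier_vec n" for M N :: "complex mat" and z
    using that by (simp add: add_mult_distrib_mat_vec[of _ n n] add_scalar_prod_distrib[of _ n])
  have ad: "a j \<le> d j + t" if "j < n" for j
  proof (rule weyl_monotone[OF A BG d _ that])
    fix z :: "complex vec" assume z: "z \<in> carrier_vec n"
    have "(\<Sum>i<n. c i * (cmod (z \<bullet>c e i))\<^sup>2)
        \<le> (\<Sum>i<n. max (c i - t) 0 * (cmod (z \<bullet>c e i))\<^sup>2 + t * (cmod (z \<bullet>c e i))\<^sup>2)"
      by (intro sum_mono) (auto simp: distrib_right[symmetric] intro!: mult_right_mono)
    then have "Re ((C *\<^sub>v z) \<bullet>c z) \<le> Re ((G *\<^sub>v z) \<bullet>c z) + t * Re (z \<bullet>c z)"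
      unfolding eigsys_quadratic_form[OF C(1,2) z] eigsys_quadratic_form[OF G z] onb_norm[OF e z]
      by (simp add: sum.distrib sum_distrib_left)
    then show "Re ((A *\<^sub>v z) \<bullet>c z) \<le> Re (((B + G) *\<^sub>v z) \<bullet>c z) + t * Re (z \<bullet>c z)"
      unfolding ABC using add_form[OF B(1) C(1) z] add_form[OF B(1) G(1) z] by simp
  qed
  have bd: "b j \<le> d j" if "j < n" for j
  proof -
    have "b j \<le> d j + 0"
    proof (rule weyl_monotone[OF B BG d _ that])
      fix z :: "complex vec" assume z: "z \<in> carrier_vec n"
      have "0 \<le> Re ((G *\<^sub>v z) \<bullet>c z)"
        unfolding eigsys_quadratic_form[OF G z] by (intro sum_nonneg) auto
      then show "Re ((B *\<^sub>v z) \<bullet>c z) \<le> Re (((B + G) *\<^sub>v z) \<bullet>c z) + 0 * Re (z \<bullet>c z)"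
        using add_form[OF B(1) G(1) z] by simp
    qed
    then show ?thesis by simp
  qed
  have "(\<Sum>r<n. (B + G) $$ (r, r)) = (\<Sum>r<n. B $$ (r, r)) + (\<Sum>r<n. G $$ (r, r))"
    using B(1) G(1) by (simp add: sum.distrib)
  then have "complex_of_real (\<Sum>i<n. d i) = of_real ((\<Sum>i<n. b i) + (\<Sum>i<n. max (c i - t) 0))"
    unfolding eigsys_trace[OF BG d(1)] eigsys_trace[OF B(1,2)] eigsys_trace[OF G] by simp
  then have tr: "(\<Sum>i<n. d i) = (\<Sum>i<n. b i) + (\<Sum>i<n. max (c i - t) 0)"
    by (simp only: of_real_eq_iff)
  \<comment> \<open>The positive part lives on the first \<open>k\<close> indices, ties with
    \<open>t\<close> contributing zero. The term \<open>real k * t\<close> subtracted here cancels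
    against the shift in \<open>ad\<close>.\<close>
  have "(\<Sum>i<n. max (c i - t) 0) = (\<Sum>i<n. if i < k then c i - t else 0)"
  proof (intro sum.cong refl)
    fix i assume "i \<in> {..<n}"
    then have i: "i < n" by simp
    have "t \<le> c i" if "i < k" using descD[OF C(3), of i "k - 1"] that k by (simp add: t_def)
    moreover have "c i \<le> t" if "\<not> i < k" using descD[OF C(3), of "k - 1" i] that i by (simp add: t_def)
    ultimately show "max (c i - t) 0 = (if i < k then c i - t else 0)" by simp
  qed
  also have "\<dots> = (\<Sum>i<k. c i - t)"
    using k by (intro sum.mono_neutral_cong_right) auto
  finally have pos: "(\<Sum>i<n. max (c i - t) 0) = (\<Sum>i<k. c i) - real k * t"
    by (simp add: sum_subtractf)
  have "(\<Sum>j\<in>J. a j - b j) \<le> (\<Sum>j\<in>J. t + (d j - b j))"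
    using J ad by (intro sum_mono) (fastforce simp: subset_iff)
  also have "\<dots> = real k * t + (\<Sum>j\<in>J. d j - b j)" by (simp add: sum.distrib k_def)
  also have "(\<Sum>j\<in>J. d j - b j) \<le> (\<Sum>j<n. d j - b j)"
    using J bd by (intro sum_mono2) auto
  also have "(\<Sum>j<n. d j - b j) = (\<Sum>i<k. c i) - real k * t"
    using tr pos by (simp add: sum_subtractf)
  finally show ?thesis by (simp add: k_def)
qed simp

section \<open>Singular values\<close>

lemma adjoint_mult_vec_carrier [simp]:
  "A \<in> carrier_mat p q \<Longrightarrow> mat_adjoint A *\<^sub>v v \<in> carrier_vec q"
  by (auto intro: carrier_vecI)

text \<open>Moving one factor \<open>A\<close> across the inner product leaves the Gramian acting on
  \<open>g j\<close>. The singular value decomposition rests on this: images of a Gramian eigenbasis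
  stay orthogonal.\<close>

lemma gram_eigenvectors_prod:
  fixes A :: "complex mat"
  assumes A: "A \<in> carrier_mat p q" and e: "eigsys q (mat_adjoint A * A) g a"
    and i: "i < q" and j: "j < q"
  shows "(A *\<^sub>v g i) \<bullet>c (A *\<^sub>v g j) = (if i = j then of_real (a i) else 0)"
proof -
  have g: "onb q g" by (rule eigsys_onb[OF e])
  have gc: "g i \<in> carrier_vec q" "g j \<in> carrier_vec q"
    using orthonormal_carrier[OF g] i j by auto
  have "mat_adjoint A *\<^sub>v (A *\<^sub>v g j) = of_real (a j) \<cdot>\<^sub>v g j"
    using eigsys_mult[OF e j] assoc_mult_mat_vec[OF mat_adjoint_carrier[OF A] A gc(2)] by simp
  then have "(A *\<^sub>v g i) \<bullet>c (A *\<^sub>v g j) = of_real (a j) * (g i \<bullet>c g j)"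
    using cscalar_prod_adjoint[OF A gc(1), of "A *\<^sub>v g j"] A gc
    by (simp add: cscalar_prod_smult_right[of _ q])
  then show ?thesis using orthonormal_prod[OF g i j] by simp
qed

lemma gram_eigenvalue_nonneg:
  fixes A :: "complex mat"
  assumes A: "A \<in> carrier_mat p q" and e: "eigsys q (mat_adjoint A * A) g a" and i: "i < q"
  shows "0 \<le> a i"
proof -
  have "A *\<^sub>v g i \<in> carrier_vec p"
    using A orthonormal_carrier[OF eigsys_onb[OF e] i] by simp
  then have "0 \<le> Re ((A *\<^sub>v g i) \<bullet>c (A *\<^sub>v g i))"
    by (simp add: cscalar_prod_self[of _ p] sum_nonneg del: of_real_sum)
  then show ?thesis using gram_eigenvectors_prod[OF A e i i] by simp
qed

lemma gram_eigenvalue_zero: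
  fixes A :: "complex mat"
  assumes A: "A \<in> carrier_mat p q" and e: "eigsys q (mat_adjoint A * A) g a" and i: "i < q"
    and "a i = 0"
  shows "A *\<^sub>v g i = 0\<^sub>v p"
proof -
  have "A *\<^sub>v g i \<in> carrier_vec p"
    using A orthonormal_carrier[OF eigsys_onb[OF e] i] by simp
  then show ?thesis
    using gram_eigenvectors_prod[OF A e i i] \<open>a i = 0\<close> conjugate_square_eq_0_vec by auto
qed

text \<open>The left singular vectors. For \<open>a i = 0\<close> the convention
  \<open>1 / 0 = 0\<close> yields the zero vector, so only positive eigenvalues give unit
  vectors.\<close>

definition left_vec :: "complex mat \<Rightarrow> (nat \<Rightarrow> complex vec) \<Rightarrow> (nat \<Rightarrow> real) \<Rightarrow> nat \<Rightarrow> complex vec" where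
  "left_vec A g a i = of_real (1 / sqrt (a i)) \<cdot>\<^sub>v (A *\<^sub>v g i)"

lemma left_vec:
  fixes A :: "complex mat"
  assumes A: "A \<in> carrier_mat p q" and e: "eigsys q (mat_adjoint A * A) g a" and i: "i < q"
    and pos: "0 < a i"
  shows "left_vec A g a i \<in> carrier_vec p"
    and "A *\<^sub>v g i = of_real (sqrt (a i)) \<cdot>\<^sub>v left_vec A g a i"
    and "mat_adjoint A *\<^sub>v left_vec A g a i = of_real (sqrt (a i)) \<cdot>\<^sub>v g i"
proof -
  have gc: "g i \<in> carrier_vec q" using orthonormal_carrier[OF eigsys_onb[OF e] i] .
  have Ag: "A *\<^sub>v g i \<in> carrier_vec p" using A gc by simp
  then show "left_vec A g a i \<in> carrier_vec p" by (simp add: left_vec_def)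
  have "sqrt (a i) * (1 / sqrt (a i)) = 1" using pos by simp
  then have "complex_of_real (sqrt (a i)) * of_real (1 / sqrt (a i)) = 1"
    by (metis of_real_1 of_real_mult)
  then show "A *\<^sub>v g i = of_real (sqrt (a i)) \<cdot>\<^sub>v left_vec A g a i"
    unfolding left_vec_def smult_smult_assoc by simp
  have "1 / sqrt (a i) * a i = sqrt (a i)" using pos by (simp add: real_div_sqrt)
  then have s: "complex_of_real (1 / sqrt (a i)) * of_real (a i) = of_real (sqrt (a i))"
    by (metis of_real_mult)
  have "mat_adjoint A *\<^sub>v left_vec A g a i = of_real (1 / sqrt (a i)) \<cdot>\<^sub>v (mat_adjoint A *\<^sub>v (A *\<^sub>v g i))"
    unfolding left_vec_def by (rule mult_mat_vec[OF mat_adjoint_carrier[OF A] Ag])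
  also have "mat_adjoint A *\<^sub>v (A *\<^sub>v g i) = of_real (a i) \<cdot>\<^sub>v g i"
    using eigsys_mult[OF e i] assoc_mult_mat_vec[OF mat_adjoint_carrier[OF A] A gc] by simp
  finally show "mat_adjoint A *\<^sub>v left_vec A g a i = of_real (sqrt (a i)) \<cdot>\<^sub>v g i"
    unfolding smult_smult_assoc s .
qed

lemma orthonormal_left_vec:
  fixes A :: "complex mat"
  assumes A: "A \<in> carrier_mat p q" and e: "eigsys q (mat_adjoint A * A) g a"
    and k: "k \<le> q" and pos: "\<And>i. i < k \<Longrightarrow> 0 < a i"
  shows "orthonormal p k (left_vec A g a)"
  unfolding orthonormal_def
proof (intro conjI allI impI)
  fix i assume i: "i < k"
  then show "left_vec A g a i \<in> carrier_vec p" using left_vec(1)[OF A e _ pos[OF i]] k by simp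
  fix j assume j: "j < k"
  have iq: "i < q" and jq: "j < q" using i j k by auto
  have c: "A *\<^sub>v g i \<in> carrier_vec p" "A *\<^sub>v g j \<in> carrier_vec p"
    using A orthonormal_carrier[OF eigsys_onb[OF e]] iq jq by auto
  have "1 / sqrt (a i) * (1 / sqrt (a i) * a i) = 1" using pos[OF i] by (simp add: real_div_sqrt)
  then have "complex_of_real (1 / sqrt (a i)) * (of_real (1 / sqrt (a i)) * of_real (a i)) = 1"
    by (metis of_real_1 of_real_mult)
  then show "left_vec A g a i \<bullet>c left_vec A g a j = (if i = j then 1 else 0)"
    unfolding left_vec_def using c gram_eigenvectors_prod[OF A e iq jq]
    by (auto simp: cscalar_prod_smult_left[of _ p] cscalar_prod_smult_right[of _ p]
        simp del: of_real_divide)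
qed

text \<open>Both equations are recorded because an eigenvector of the Hermitian dilation combines
  \<open>u i\<close> with \<open>g i\<close> and calls for each of them.\<close>

definition svd :: "nat \<Rightarrow> complex mat \<Rightarrow> (nat \<Rightarrow> complex vec) \<Rightarrow> (nat \<Rightarrow> complex vec) \<Rightarrow> (nat \<Rightarrow> real) \<Rightarrow> bool" where
  "svd n A u g s \<longleftrightarrow> onb n u \<and> onb n g \<and> desc n s \<and> (\<forall>i<n. 0 \<le> s i) \<and>
     (\<forall>i<n. A *\<^sub>v g i = of_real (s i) \<cdot>\<^sub>v u i) \<and>
     (\<forall>i<n. mat_adjoint A *\<^sub>v u i = of_real (s i) \<cdot>\<^sub>v g i)"

text \<open>Positive eigenvalues come first and give left vectors directly; these are completed to a
  basis, since the vectors belonging to the value 0 may be chosen freely.\<close>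

lemma svd_exists:
  fixes A :: "complex mat"
  assumes A: "A \<in> carrier_mat n n" and e: "eigsys n (mat_adjoint A * A) g a" and d: "desc n a"
  shows "\<exists>u. svd n A u g (\<lambda>i. sqrt (a i))"
proof -
  have a0: "\<And>i. i < n \<Longrightarrow> 0 \<le> a i" using gram_eigenvalue_nonneg[OF A e] .
  obtain k where k: "k \<le> n" "\<And>i. i < n \<Longrightarrow> 0 < a i \<longleftrightarrow> i < k"
    using downward_closed_threshold[of n "\<lambda>i. 0 < a i"] descD[OF d] by (metis less_le_trans)
  have pos: "0 < a i" if "i < k" for i using k that by auto
  obtain u where u: "onb n u" "\<And>i. i < k \<Longrightarrow> u i = left_vec A g a i"
    using orthonormal_extend[OF orthonormal_left_vec[OF A e k(1) pos] k(1)] by blast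
  have g: "onb n g" by (rule eigsys_onb[OF e])
  have Ag: "A *\<^sub>v g i = of_real (sqrt (a i)) \<cdot>\<^sub>v u i" if i: "i < n" for i
  proof (cases "i < k")
    case True
    then show ?thesis using left_vec(2)[OF A e i pos[OF True]] u(2) by simp
  next
    case False
    then have "a i = 0" using k(2)[OF i] a0[OF i] by simp
    then show ?thesis using gram_eigenvalue_zero[OF A e i] orthonormal_carrier[OF u(1) i]
      by (intro eq_vecI) auto
  qed
  \<comment> \<open>Completed vectors have no formula in terms of \<open>A\<close>, hence the test
    against every \<open>g j\<close>, where \<open>Ag\<close> applies and only \<open>j = i\<close>
    survives.\<close>
  have Au: "mat_adjoint A *\<^sub>v u i = of_real (sqrt (a i)) \<cdot>\<^sub>v g i" if i: "i < n" for i
  proof (rule onb_vec_eqI[OF g])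
    have uc: "u i \<in> carrier_vec n" using orthonormal_carrier[OF u(1) i] .
    fix j assume j: "j < n"
    have gc: "g j \<in> carrier_vec n" "u j \<in> carrier_vec n"
      using orthonormal_carrier[OF g j] orthonormal_carrier[OF u(1) j] .
    have "(mat_adjoint A *\<^sub>v u i) \<bullet>c g j = u i \<bullet>c (of_real (sqrt (a j)) \<cdot>\<^sub>v u j)"
      using cscalar_prod_adjoint[OF mat_adjoint_carrier[OF A] uc gc(1)] Ag[OF j] by simp
    also have "\<dots> = of_real (sqrt (a j)) * (if i = j then 1 else 0)"
      using uc gc orthonormal_prod[OF u(1) i j] by (simp add: cscalar_prod_smult_right[of _ n])
    also have "\<dots> = (of_real (sqrt (a i)) \<cdot>\<^sub>v g i) \<bullet>c g j"
      using gc orthonormal_prod[OF g i j] orthonormal_carrier[OF g i]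
      by (simp add: cscalar_prod_smult_left[of _ n])
    finally show "(mat_adjoint A *\<^sub>v u i) \<bullet>c g j = (of_real (sqrt (a i)) \<cdot>\<^sub>v g i) \<bullet>c g j" .
  qed (use A orthonormal_carrier[OF u(1) i] orthonormal_carrier[OF g i] in auto)
  have "desc n (\<lambda>i. sqrt (a i))" using d by (simp add: desc_def)
  then have "svd n A u g (\<lambda>i. sqrt (a i))"
    unfolding svd_def using u(1) g a0 Ag Au by simp
  then show ?thesis by blast
qed

lemma svd_gram:
  assumes A: "A \<in> carrier_mat n n"
  shows "\<exists>u g. svd n A u g (\<lambda>i. sqrt (eigvals_desc (mat_adjoint A * A) ! i))"
proof -
  have c: "mat_adjoint A * A \<in> carrier_mat n n" using A by auto
  show ?thesis
    using spectral_theorem_desc[OF c hermitian_gram] svd_exists[OF A] by blast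
qed

section \<open>Mirsky's inequality\<close>

text \<open>A Hermitian matrix whose eigenvalues are the singular values of \<open>A\<close> with
  both signs. Being additive in \<open>A\<close>, it carries a sum of arbitrary matrices to a sum of
  Hermitian ones.\<close>

definition dilation :: "nat \<Rightarrow> complex mat \<Rightarrow> complex mat" where
  "dilation n A = four_block_mat (0\<^sub>m n n) A (mat_adjoint A) (0\<^sub>m n n)"

text \<open>For unit vectors forming a singular pair with value \<open>s\<close>, and
  \<open>r\<close> equal to 1 or -1, this is the normalized eigenvector of the dilation for
  \<open>r * s\<close>.\<close>

definition pair_vec :: "complex vec \<Rightarrow> complex vec \<Rightarrow> real \<Rightarrow> complex vec" where
  "pair_vec u g r = of_real (1 / sqrt 2) \<cdot>\<^sub>v (u @\<^sub>v (of_real r \<cdot>\<^sub>v g))"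

lemma pair_vec_carrier [simp, intro]:
  "u \<in> carrier_vec n \<Longrightarrow> g \<in> carrier_vec n \<Longrightarrow> pair_vec u g r \<in> carrier_vec (n + n)"
  by (simp add: pair_vec_def)

lemma pair_vec_prod:
  assumes "u \<in> carrier_vec n" "g \<in> carrier_vec n" "u' \<in> carrier_vec n" "g' \<in> carrier_vec n"
  shows "pair_vec u g r \<bullet>c pair_vec u' g' r'
    = (u \<bullet>c u' + of_real (r * r') * (g \<bullet>c g')) / 2"
proof -
  have app: "(x @\<^sub>v y) \<bullet>c (x' @\<^sub>v y') = x \<bullet>c x' + y \<bullet>c y'"
    if "x \<in> carrier_vec n" "y \<in> carrier_vec n" "x' \<in> carrier_vec n" "y' \<in> carrier_vec n"
    for x y x' y' :: "complex vec"
  proof -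
    have "conjugate (x' @\<^sub>v y') = conjugate x' @\<^sub>v conjugate y'"
      using that by (intro eq_vecI) auto
    then show ?thesis using that scalar_prod_append[of x n y n "conjugate x'" "conjugate y'"] by simp
  qed
  have half: "complex_of_real (1 / sqrt 2) * of_real (1 / sqrt 2) = 1 / 2"
    by (simp flip: of_real_mult)
  have "pair_vec u g r \<bullet>c pair_vec u' g' r'
      = of_real (1 / sqrt 2) * (of_real (1 / sqrt 2) * (u \<bullet>c u' + of_real (r * r') * (g \<bullet>c g')))"
    unfolding pair_vec_def using assms
    by (simp add: cscalar_prod_smult_left[of _ "n + n"] cscalar_prod_smult_right[of _ "n + n"] app
        cscalar_prod_smult_left[of _ n] cscalar_prod_smult_right[of _ n] mult_ac del: of_real_divide)
  also have "\<dots> = (u \<bullet>c u' + of_real (r * r') * (g \<bullet>c g')) / 2"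
    unfolding mult.assoc[symmetric] half by simp
  finally show ?thesis .
qed

lemma dilation_pair_vec:
  assumes A: "A \<in> carrier_mat n n" and u: "u \<in> carrier_vec n" and g: "g \<in> carrier_vec n"
    and Ag: "A *\<^sub>v g = of_real s \<cdot>\<^sub>v u" and Au: "mat_adjoint A *\<^sub>v u = of_real s \<cdot>\<^sub>v g"
    and r: "r * r = 1"
  shows "dilation n A *\<^sub>v pair_vec u g r = of_real (r * s) \<cdot>\<^sub>v pair_vec u g r"
proof -
  have rg: "of_real r \<cdot>\<^sub>v g \<in> carrier_vec n" using g by simp
  have "r * s * r = r * r * s" by simp
  then have "r * s * r = s" using r by simp
  then have rr: "complex_of_real (r * s) * of_real r = of_real s" by (metis of_real_mult)
  have "dilation n A *\<^sub>v (u @\<^sub>v (of_real r \<cdot>\<^sub>v g))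
      = (A *\<^sub>v (of_real r \<cdot>\<^sub>v g)) @\<^sub>v (mat_adjoint A *\<^sub>v u)"
    unfolding dilation_def using A u rg
    by (subst four_block_mat_mult_vec[of _ n n _ n _ n]) auto
  also have "A *\<^sub>v (of_real r \<cdot>\<^sub>v g) = of_real (r * s) \<cdot>\<^sub>v u"
    using mult_mat_vec[OF A g] Ag by (simp add: smult_smult_assoc)
  also have "mat_adjoint A *\<^sub>v u = of_real (r * s) \<cdot>\<^sub>v (of_real r \<cdot>\<^sub>v g)"
    unfolding Au smult_smult_assoc rr ..
  also have "(of_real (r * s) \<cdot>\<^sub>v u) @\<^sub>v (of_real (r * s) \<cdot>\<^sub>v (of_real r \<cdot>\<^sub>v g))
      = of_real (r * s) \<cdot>\<^sub>v (u @\<^sub>v (of_real r \<cdot>\<^sub>v g))"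
    using u g by (intro eq_vecI) auto
  finally have *: "dilation n A *\<^sub>v (u @\<^sub>v (of_real r \<cdot>\<^sub>v g))
      = of_real (r * s) \<cdot>\<^sub>v (u @\<^sub>v (of_real r \<cdot>\<^sub>v g))" .
  have D: "dilation n A \<in> carrier_mat (n + n) (n + n)"
    using A by (auto simp: dilation_def)
  have c: "u @\<^sub>v (of_real r \<cdot>\<^sub>v g) \<in> carrier_vec (n + n)" using u rg by simp
  show ?thesis
    unfolding pair_vec_def mult_mat_vec[OF D c] * smult_smult_assoc by (simp only: mult.commute)
qed

text \<open>The second half runs backwards through \<open>n + n - 1 - i\<close>, so that
  \<open>dilation_val\<close> lists the negated singular values in non-increasing order, as
  Lidskii's inequality demands.\<close>

definition dilation_vec :: "nat \<Rightarrow> (nat \<Rightarrow> complex vec) \<Rightarrow> (nat \<Rightarrow> complex vec) \<Rightarrow> nat \<Rightarrow> complex vec" where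
  "dilation_vec n u g i = (if i < n then pair_vec (u i) (g i) 1
     else pair_vec (u (n + n - 1 - i)) (g (n + n - 1 - i)) (-1))"

definition dilation_val :: "nat \<Rightarrow> (nat \<Rightarrow> real) \<Rightarrow> nat \<Rightarrow> real" where
  "dilation_val n s i = (if i < n then s i else - s (n + n - 1 - i))"

lemma dilation_carrier: "A \<in> carrier_mat n n \<Longrightarrow> dilation n A \<in> carrier_mat (n + n) (n + n)"
  by (auto simp: dilation_def)

lemma eigsys_dilation:
  assumes A: "A \<in> carrier_mat n n" and svd: "svd n A u g s"
  shows "eigsys (n + n) (dilation n A) (dilation_vec n u g) (dilation_val n s)"
    and "desc (n + n) (dilation_val n s)"
proof -
  have u: "onb n u" and g: "onb n g" and d: "desc n s" and s0: "\<And>i. i < n \<Longrightarrow> 0 \<le> s i"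
    and Ag: "\<And>i. i < n \<Longrightarrow> A *\<^sub>v g i = of_real (s i) \<cdot>\<^sub>v u i"
    and Au: "\<And>i. i < n \<Longrightarrow> mat_adjoint A *\<^sub>v u i = of_real (s i) \<cdot>\<^sub>v g i"
    using svd by (auto simp: svd_def)
  have uc: "\<And>i. i < n \<Longrightarrow> u i \<in> carrier_vec n" and gc: "\<And>i. i < n \<Longrightarrow> g i \<in> carrier_vec n"
    using orthonormal_carrier u g by blast+
  have pp: "pair_vec (u i) (g i) r \<bullet>c pair_vec (u j) (g j) r' = (if i = j \<and> r = r' then 1 else 0)"
    if "i < n" "j < n" "r \<in> {1, -1}" "r' \<in> {1, -1}" for i j r r'
    using that pair_vec_prod[OF uc gc uc gc, of i i j j r r'] orthonormal_prod[OF u, of i j]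
      orthonormal_prod[OF g, of i j] by auto
  have "onb (n + n) (dilation_vec n u g)"
    unfolding orthonormal_def
  proof (intro conjI allI impI)
    fix i assume i: "i < n + n"
    show "dilation_vec n u g i \<in> carrier_vec (n + n)"
      using i uc gc by (auto simp: dilation_vec_def)
    fix j assume j: "j < n + n"
    show "dilation_vec n u g i \<bullet>c dilation_vec n u g j = (if i = j then 1 else 0)"
      using i j by (auto simp: dilation_vec_def pp)
  qed
  moreover have "dilation n A *\<^sub>v dilation_vec n u g i
      = of_real (dilation_val n s i) \<cdot>\<^sub>v dilation_vec n u g i" if i: "i < n + n" for i
  proof (cases "i < n")
    case True
    then show ?thesis
      using dilation_pair_vec[OF A uc[OF True] gc[OF True] Ag[OF True] Au[OF True], of 1] by (simp add: dilation_vec_def dilation_val_def)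
  next
    case False
    then have l: "n + n - 1 - i < n" using i by simp
    then show ?thesis using False dilation_pair_vec[OF A uc[OF l] gc[OF l] Ag[OF l] Au[OF l], of "-1"]
      by (simp add: dilation_vec_def dilation_val_def)
  qed
  ultimately show "eigsys (n + n) (dilation n A) (dilation_vec n u g) (dilation_val n s)"
    by (simp add: eigsys_def)
  show "desc (n + n) (dilation_val n s)"
    unfolding desc_def
  proof (intro allI impI)
    fix i j assume ij: "i \<le> j" "j < n + n"
    \<comment> \<open>Across the middle the order comes from \<open>s\<close> being nonnegative, in
      the second half from the reversal of indices.\<close>
    consider "j < n" | "i < n" "n \<le> j" | "n \<le> i" by linarith
    then show "dilation_val n s j \<le> dilation_val n s i"
    proof cases
      case 1
      then show ?thesis using ij descD[OF d] by (simp add: dilation_val_def)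
    next
      case 2
      then have "0 \<le> s i" "0 \<le> s (n + n - 1 - j)" using ij s0 by auto
      then show ?thesis using 2 by (simp add: dilation_val_def)
    next
      case 3
      then have "s (n + n - 1 - i) \<le> s (n + n - 1 - j)" using ij by (intro descD[OF d]) auto
      then show ?thesis using 3 ij by (simp add: dilation_val_def)
    qed
  qed
qed

text \<open>An absolute difference is a difference of dilation eigenvalues at \<open>j\<close> or,
  if that one is negative, at the mirror index \<open>n + n - 1 - j\<close>. Lidskii's inequality
  allows any index set, so the right choice can be made for each \<open>j\<close>
  separately.\<close>

theorem mirsky:
  assumes A: "A \<in> carrier_mat n n" "svd n A u g s"
    and B: "B \<in> carrier_mat n n" "svd n B u' g' s'"
    and C: "C \<in> carrier_mat n n" "svd n C u'' g'' c"
    and ABC: "A = B + C" and J: "J \<subseteq> {..<n}"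
  shows "(\<Sum>j\<in>J. \<bar>s j - s' j\<bar>) \<le> (\<Sum>i<card J. c i)"
proof -
  define P where "P = {j \<in> J. s' j \<le> s j}"
  define Q where "Q = {j \<in> J. s j < s' j}"
  \<comment> \<open>Mirror indices are all at least \<open>n\<close>, so this union is disjoint and
    has as many elements as \<open>J\<close>.\<close>
  define K where "K = P \<union> (\<lambda>j. n + n - 1 - j) ` Q"
  have fin: "finite J" using J finite_subset by blast
  have PQ: "J = P \<union> Q" "P \<inter> Q = {}" "finite P" "finite Q" using fin by (auto simp: P_def Q_def)
  have PQn: "P \<subseteq> {..<n}" "Q \<subseteq> {..<n}" using J by (auto simp: P_def Q_def)
  have inj: "inj_on (\<lambda>j. n + n - 1 - j) Q"
  proof (rule inj_onI)
    fix x y assume "x \<in> Q" "y \<in> Q" "n + n - 1 - x = n + n - 1 - y"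
    moreover have "x < n" "y < n" using \<open>x \<in> Q\<close> \<open>y \<in> Q\<close> PQn by auto
    ultimately show "x = y" by simp
  qed
  have disj: "P \<inter> (\<lambda>j. n + n - 1 - j) ` Q = {}" using PQn by fastforce
  have Kn: "K \<subseteq> {..<n + n}" using PQn by (fastforce simp: K_def)
  have card: "card K = card J"
    unfolding K_def PQ(1) using PQ(2-) disj inj by (simp add: card_Un_disjoint card_image)
  have "(\<Sum>j\<in>J. \<bar>s j - s' j\<bar>) = (\<Sum>j\<in>P. \<bar>s j - s' j\<bar>) + (\<Sum>j\<in>Q. \<bar>s j - s' j\<bar>)"
    unfolding PQ(1) using PQ(2-) by (intro sum.union_disjoint) auto
  also have "(\<Sum>j\<in>P. \<bar>s j - s' j\<bar>) = (\<Sum>j\<in>P. dilation_val n s j - dilation_val n s' j)"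
    using PQn by (intro sum.cong) (auto simp: P_def dilation_val_def)
  also have "(\<Sum>j\<in>Q. \<bar>s j - s' j\<bar>)
      = (\<Sum>j\<in>Q. dilation_val n s (n + n - 1 - j) - dilation_val n s' (n + n - 1 - j))"
  proof (rule sum.cong[OF refl])
    fix j assume j: "j \<in> Q"
    then have "j < n" "s j < s' j" using PQn by (auto simp: Q_def)
    moreover have "\<not> n + n - 1 - j < n" "n + n - 1 - (n + n - 1 - j) = j" using \<open>j < n\<close> by auto
    ultimately show "\<bar>s j - s' j\<bar>
        = dilation_val n s (n + n - 1 - j) - dilation_val n s' (n + n - 1 - j)"
      unfolding dilation_val_def by simp
  qed
  also have "\<dots> = (\<Sum>j\<in>(\<lambda>j. n + n - 1 - j) ` Q. dilation_val n s j - dilation_val n s' j)"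
    using inj by (simp add: sum.reindex)
  also have "(\<Sum>j\<in>P. dilation_val n s j - dilation_val n s' j) + \<dots>
      = (\<Sum>j\<in>K. dilation_val n s j - dilation_val n s' j)"
    unfolding K_def using PQ disj by (intro sum.union_disjoint[symmetric]) auto
  also have "\<dots> \<le> (\<Sum>i<card K. dilation_val n c i)"
  proof (rule lidskii)
    show "dilation n A = dilation n B + dilation n C"
      unfolding dilation_def ABC using B(1) C(1)
      by (subst add_four_block_mat[of _ n n _ n _ n]) (auto intro!: arg_cong2[where f = "\<lambda>x y. four_block_mat (0\<^sub>m n n) x y (0\<^sub>m n n)"])
  qed (use A B C Kn dilation_carrier eigsys_dilation in auto)
  \<comment> \<open>At most \<open>n\<close> indices are summed, so only the nonnegative half of the
    dilation of \<open>C\<close> is met.\<close>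
  also have "\<dots> = (\<Sum>i<card J. c i)"
    unfolding card using card_mono[OF finite_lessThan J]
    by (intro sum.cong) (auto simp: dilation_val_def)
  finally show ?thesis .
qed

section \<open>Unitarily invariant norms\<close>

lemma real_diag_cong: "(\<And>i. i < n \<Longrightarrow> x i = y i) \<Longrightarrow> real_diag n x = real_diag n y"
  by (auto simp: real_diag_def intro!: eq_matI)

text \<open>The two unitary factors of the decomposition disappear under \<open>N\<close>, so norms
  can be computed on real diagonal matrices.\<close>

lemma uin_norm_decomposition:
  assumes N: "unitarily_invariant_norm n N" and A: "A \<in> carrier_mat n n"
    and u: "onb n u" and g: "onb n g"
    and eq: "\<And>i. i < n \<Longrightarrow> A *\<^sub>v g i = of_real (s i) \<cdot>\<^sub>v u i"
  shows "N A = N (real_diag n s)"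
proof -
  have "unitary_mat n (onb_mat n u)" "unitary_mat n (mat_adjoint (onb_mat n g))"
    using unitary_onb_mat[OF u] unitary_mat_adjoint[OF unitary_onb_mat[OF g]] by auto
  then show ?thesis
    using N decomposition_by_onbs[OF u g A eq] unfolding unitarily_invariant_norm_def by auto
qed

lemma uin_norm_svd:
  assumes "unitarily_invariant_norm n N" "A \<in> carrier_mat n n" "svd n A u g s"
  shows "N A = N (real_diag n s)"
  using assms by (intro uin_norm_decomposition[of n N A u g s]) (auto simp: svd_def)

lemma uin_norm_eigsys:
  assumes "unitarily_invariant_norm n N" "A \<in> carrier_mat n n" "eigsys n A g a"
  shows "N A = N (real_diag n a)"
  using assms by (intro uin_norm_decomposition[of n N A g g a]) (auto simp: eigsys_def)

text \<open>The matrix \<open>real_diag n x\<close> is kept; only its eigenbasis of unit vectors is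
  listed in another order.\<close>

lemma uin_norm_permute:
  assumes N: "unitarily_invariant_norm n N" and p: "p permutes {..<n}"
  shows "N (real_diag n (\<lambda>i. x (p i))) = N (real_diag n x)"
proof -
  have "p i < n" if "i < n" for i using permutes_in_image[OF p, of i] that by simp
  then show ?thesis
    using uin_norm_decomposition[OF N real_diag_carrier onb_permute[OF onb_unit_vec p] onb_permute[OF onb_unit_vec p],
      of x "\<lambda>i. x (p i)"] real_diag_mult_unit by simp
qed

text \<open>The signs are absorbed into the left basis: \<open>x i\<close> times a unit vector is
  \<open>r i * x i\<close> times that vector with sign \<open>r i\<close>.\<close>

lemma uin_norm_sign:
  assumes N: "unitarily_invariant_norm n N" and r: "\<And>i. i < n \<Longrightarrow> r i \<in> {-1, 1}"
  shows "N (real_diag n (\<lambda>i. r i * x i)) = N (real_diag n x)"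
proof -
  have rr: "complex_of_real (r i) * of_real (r i) = 1" if "i < n" for i
    using r[OF that] by auto
  have "onb n (\<lambda>i. of_real (r i) \<cdot>\<^sub>v unit_vec n i)"
    using onb_unit_vec[of n] rr
    by (auto simp: orthonormal_def cscalar_prod_smult_left[of _ n] cscalar_prod_smult_right[of _ n])
  moreover have "real_diag n x *\<^sub>v unit_vec n i = of_real (r i * x i) \<cdot>\<^sub>v (of_real (r i) \<cdot>\<^sub>v unit_vec n i)"
    if i: "i < n" for i
  proof -
    have eq: "complex_of_real (r i * x i) * of_real (r i) = of_real (x i)"
      using rr[OF i] by (simp add: mult_ac)
    show ?thesis unfolding real_diag_mult_unit[OF i] smult_smult_assoc eq ..
  qed
  ultimately show ?thesis
    using uin_norm_decomposition[OF N real_diag_carrier _ onb_unit_vec, of _ x "\<lambda>i. r i * x i"] by simp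
qed

lemma uin_norm_abs:
  assumes N: "unitarily_invariant_norm n N"
  shows "N (real_diag n (\<lambda>i. \<bar>x i\<bar>)) = N (real_diag n x)"
proof -
  have "N (real_diag n (\<lambda>i. (if 0 \<le> x i then 1 else -1) * x i)) = N (real_diag n x)"
    by (rule uin_norm_sign[OF N]) auto
  moreover have "(\<lambda>i. (if 0 \<le> x i then 1 else -1) * x i) = (\<lambda>i. \<bar>x i\<bar>)" by auto
  ultimately show ?thesis by simp
qed

text \<open>Averaging with a copy of equal norm cannot raise the norm. The copies used are sign
  changes, for monotonicity, and transpositions, for majorization.\<close>

lemma uin_norm_convex:
  assumes N: "unitarily_invariant_norm n N" and t: "0 \<le> t" "t \<le> 1"
    and eq: "N (real_diag n y) = N (real_diag n x)"
  shows "N (real_diag n (\<lambda>i. (1 - t) * x i + t * y i)) \<le> N (real_diag n x)"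
proof -
  have nrm: "matrix_norm n N" using N by (simp add: unitarily_invariant_norm_def)
  have "real_diag n (\<lambda>i. (1 - t) * x i + t * y i)
      = of_real (1 - t) \<cdot>\<^sub>m real_diag n x + of_real t \<cdot>\<^sub>m real_diag n y"
    by (rule eq_matI) (auto simp: real_diag_def)
  then have "N (real_diag n (\<lambda>i. (1 - t) * x i + t * y i))
      \<le> N (of_real (1 - t) \<cdot>\<^sub>m real_diag n x) + N (of_real t \<cdot>\<^sub>m real_diag n y)"
    using nrm unfolding matrix_norm_def by (metis real_diag_carrier smult_carrier_mat)
  also have "N (of_real (1 - t) \<cdot>\<^sub>m real_diag n x) = (1 - t) * N (real_diag n x)"
    using nrm t by (simp add: matrix_norm_def del: of_real_diff)
  also have "N (of_real t \<cdot>\<^sub>m real_diag n y) = t * N (real_diag n x)"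
    using nrm t eq by (simp add: matrix_norm_def)
  finally show ?thesis by (simp add: algebra_simps)
qed

text \<open>Entries are replaced one at a time. An entry between \<open>- y k\<close> and
  \<open>y k\<close> is an average of these endpoints, that is, it arises by averaging a diagonal
  with its sign change at \<open>k\<close>.\<close>

lemma uin_norm_mono:
  assumes N: "unitarily_invariant_norm n N" and le: "\<And>i. i < n \<Longrightarrow> \<bar>x i\<bar> \<le> y i"
  shows "N (real_diag n x) \<le> N (real_diag n y)"
proof -
  define z where "z k i = (if i < k then x i else y i)" for k i
  have "N (real_diag n (z k)) \<le> N (real_diag n y)" if "k \<le> n" for k
    using that
  proof (induction k)
    case 0
    then show ?case by (simp add: z_def)
  next
    case (Suc k)
    then have k: "k < n" by simp
    \<comment> \<open>The weight solves \<open>x k = (1 - 2 * t) * y k\<close>; if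
      \<open>y k = 0\<close> then \<open>x k = 0\<close> and any weight would do.\<close>
    define t where "t = (if y k = 0 then 0 else (1 - x k / y k) / 2)"
    define w where "w i = (if i = k then -1 else 1) * z k i" for i
    have "0 \<le> t \<and> t \<le> 1 \<and> x k = (1 - t) * y k - t * y k"
    proof (cases "y k = 0")
      case True
      then show ?thesis using le[OF k] by (simp add: t_def)
    next
      case False
      then have "0 < y k" using le[OF k] by simp
      then have "-1 \<le> x k / y k" "x k / y k \<le> 1" using le[OF k] by (simp_all add: divide_simps abs_le_iff)
      then show ?thesis using False by (simp add: t_def) (simp add: field_simps)
    qed
    then have t: "0 \<le> t" "t \<le> 1" and xk: "x k = (1 - t) * y k - t * y k" by auto
    have "N (real_diag n w) = N (real_diag n (z k))"
      unfolding w_def by (rule uin_norm_sign[OF N]) auto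
    then have "N (real_diag n (\<lambda>i. (1 - t) * z k i + t * w i)) \<le> N (real_diag n (z k))"
      by (rule uin_norm_convex[OF N t])
    moreover have "(\<lambda>i. (1 - t) * z k i + t * w i) = z (Suc k)"
      using xk by (auto simp: w_def z_def less_Suc_eq algebra_simps)
    ultimately show ?case using Suc by simp
  qed
  from this[of n] have "N (real_diag n (z n)) \<le> N (real_diag n y)" by simp
  also have "real_diag n (z n) = real_diag n x" by (rule real_diag_cong) (simp add: z_def)
  finally show ?thesis .
qed

text \<open>Induction on the number of indices at which \<open>x\<close> and \<open>y\<close> differ: a transfer of mass from
  an index \<open>j\<close> with \<open>x\<^sub>j < y\<^sub>j\<close> to the first index \<open>k\<close> with \<open>y\<^sub>k < x\<^sub>k\<close> averages \<open>y\<close> with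
  one of its transpositions and makes one more entry agree.\<close>

lemma uin_norm_weak_majorization:
  assumes N: "unitarily_invariant_norm n N" and x: "desc n x" "\<And>i. i < n \<Longrightarrow> 0 \<le> x i"
    and maj: "\<And>l. l \<le> n \<Longrightarrow> (\<Sum>i<l. x i) \<le> (\<Sum>i<l. y i)"
  shows "N (real_diag n x) \<le> N (real_diag n y)"
  using maj
proof (induction "card {i. i < n \<and> x i \<noteq> y i}" arbitrary: y rule: less_induct)
  case less
  show ?case
  proof (cases "\<forall>i<n. x i \<le> y i")
    case True
    then show ?thesis using uin_norm_mono[OF N, of x y] x(2) by simp
  next
    case False
    define k where "k = (LEAST i. i < n \<and> y i < x i)"
    have k: "k < n" "y k < x k"
      using LeastI_ex[of "\<lambda>i. i < n \<and> y i < x i"] False unfolding k_def[symmetric]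
      by (meson not_le)+
    have below: "x i \<le> y i" if "i < k" for i
      using not_less_Least[of i "\<lambda>i. i < n \<and> y i < x i"] that k(1) unfolding k_def[symmetric] by auto
    \<comment> \<open>Otherwise the first \<open>k\<close> entries agree and the prefix of length
      \<open>Suc k\<close> violates the hypothesis on sums.\<close>
    have "\<exists>j<k. x j < y j"
    proof (rule ccontr)
      assume "\<not> ?thesis"
      then have "(\<Sum>i<k. x i) = (\<Sum>i<k. y i)" using below by (intro sum.cong) force+
      then show False using less.prems[of "Suc k"] k by simp
    qed
    then obtain j where j: "j < k" "x j < y j" by blast
    \<comment> \<open>The largest transfer that leaves \<open>y' j\<close> no smaller than
      \<open>x j\<close> and \<open>y' k\<close> no larger than \<open>x k\<close>; the term
      attaining the minimum yields an equality.\<close>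
    define r where "r = min (y j - x j) (x k - y k)"
    define y' where "y' i = y i - (if i = j then r else 0) + (if i = k then r else 0)" for i
    have r: "0 < r" "r \<le> y j - x j" "r \<le> x k - y k" using j k by (auto simp: r_def)
    have xjk: "x k \<le> x j" using descD[OF x(1)] j k by simp
    have prefix: "(\<Sum>i<l. x i) \<le> (\<Sum>i<l. y' i)" if l: "l \<le> n" for l
    proof -
      have s: "(\<Sum>i<l. y' i) = (\<Sum>i<l. y i) - (if j < l then r else 0) + (if k < l then r else 0)"
        unfolding y'_def by (simp add: sum.distrib sum_subtractf)
      \<comment> \<open>Only prefixes that contain \<open>j\<close> but not \<open>k\<close> lose
        \<open>r\<close>, and their slack is at least \<open>y j - x j\<close>.\<close>
      show ?thesis
      proof (cases "j < l \<and> l \<le> k")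
        case True
        have "r \<le> y j - x j" by (rule r)
        also have "\<dots> \<le> (\<Sum>i<l. y i - x i)"
          using True below by (intro member_le_sum[of j "{..<l}" "\<lambda>i. y i - x i"]) auto
        finally show ?thesis using True by (simp add: s sum_subtractf)
      next
        case False
        then show ?thesis using less.prems[OF l] j(1) r(1) by (auto simp: s)
      qed
    qed
    have "{i. i < n \<and> x i \<noteq> y' i} \<subset> {i. i < n \<and> x i \<noteq> y i}"
    proof -
      have "{i. i < n \<and> x i \<noteq> y' i} \<subseteq> {i. i < n \<and> x i \<noteq> y i}"
        using j k by (auto simp: y'_def split: if_splits)
      moreover have "x j = y' j \<or> x k = y' k" using j(1) by (auto simp: y'_def r_def min_def)
      moreover have "j < n" "x j \<noteq> y j" "x k \<noteq> y k" using j k by auto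
      ultimately show ?thesis using k(1) by blast
    qed
    then have "card {i. i < n \<and> x i \<noteq> y' i} < card {i. i < n \<and> x i \<noteq> y i}"
      by (intro psubset_card_mono) auto
    then have "N (real_diag n x) \<le> N (real_diag n y')" using less.hyps prefix by blast
    also have "\<dots> \<le> N (real_diag n y)"
    proof -
      define p where "p = transpose j k"
      \<comment> \<open>With this weight on the transposed copy exactly \<open>r\<close> is moved;
        it is at most 1 because \<open>y k < x k \<le> x j < y j\<close>.\<close>
      define t where "t = r / (y j - y k)"
      have p: "p permutes {..<n}" unfolding p_def using j k by (intro permutes_swap_id) auto
      have d: "0 < y j - y k" using xjk j k by simp
      have t: "0 \<le> t" "t \<le> 1" using r xjk d by (auto simp: t_def)
      have tr: "t * (y j - y k) = r" using d by (simp add: t_def)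
      have "y' = (\<lambda>i. (1 - t) * y i + t * y (p i))"
      proof
        fix i
        show "y' i = (1 - t) * y i + t * y (p i)"
          using j(1) tr by (auto simp: y'_def p_def transpose_def algebra_simps)
      qed
      then show ?thesis using uin_norm_convex[OF N t uin_norm_permute[OF N p]] by simp
    qed
    finally show ?thesis .
  qed
qed

lemma ex_sorting_permutation:
  obtains p where "p permutes {..<n}" "desc n (\<lambda>i. x (p i))"
proof -
  define xs where "xs = rev (sort (map x [0..<n]))"
  have len: "length xs = n" by (simp add: xs_def)
  have "sorted_wrt (\<ge>) xs" unfolding xs_def by (simp add: sorted_wrt_rev)
  then have d: "desc n (\<lambda>i. xs ! i)" using desc_sorted_nth len by metis
  have "map (\<lambda>i. xs ! i) [0..<n] = xs" using len by (metis map_nth)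
  then have "mset (map x [0..<n]) = mset (map (\<lambda>i. xs ! i) [0..<n])" by (simp add: xs_def)
  then obtain p where p: "p permutes {..<n}" "\<And>i. i < n \<Longrightarrow> xs ! i = x (p i)"
    using permutation_of_mset_eq by blast
  have "desc n (\<lambda>i. x (p i))" using d p(2) unfolding desc_def by fastforce
  then show ?thesis using that p(1) by blast
qed

text \<open>Differences of singular values arrive unsorted. A bound over all index sets controls the
  sum of the \<open>l\<close> largest entries wherever they occur, so sorting reduces this to weak
  majorization.\<close>

lemma uin_norm_dominance:
  assumes N: "unitarily_invariant_norm n N" and x: "\<And>i. i < n \<Longrightarrow> 0 \<le> x i"
    and maj: "\<And>J. J \<subseteq> {..<n} \<Longrightarrow> (\<Sum>j\<in>J. x j) \<le> (\<Sum>i<card J. y i)"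
  shows "N (real_diag n x) \<le> N (real_diag n y)"
proof -
  obtain p where p: "p permutes {..<n}" "desc n (\<lambda>i. x (p i))" by (rule ex_sorting_permutation)
  have pn: "p i < n" if "i < n" for i using permutes_in_image[OF p(1), of i] that by simp
  have "N (real_diag n (\<lambda>i. x (p i))) \<le> N (real_diag n y)"
  proof (rule uin_norm_weak_majorization[OF N p(2)])
    fix l assume l: "l \<le> n"
    have inj: "inj_on p {..<l}" using permutes_inj_on[OF p(1)] .
    have "(\<Sum>i<l. x (p i)) = (\<Sum>j\<in>p ` {..<l}. x j)" using inj by (simp add: sum.reindex)
    also have "\<dots> \<le> (\<Sum>i<card (p ` {..<l}). y i)" using l pn by (intro maj) auto
    finally show "(\<Sum>i<l. x (p i)) \<le> (\<Sum>i<l. y i)" using inj by (simp add: card_image)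
  qed (use x pn in auto)
  then show ?thesis using uin_norm_permute[OF N p(1)] by simp
qed

corollary uin_norm_mirsky:
  assumes N: "unitarily_invariant_norm n N"
    and A: "A \<in> carrier_mat n n" "svd n A u g s"
    and B: "B \<in> carrier_mat n n" "svd n B u' g' s'"
  shows "N (real_diag n (\<lambda>i. s i - s' i)) \<le> N (A - B)"
proof -
  have C: "A - B \<in> carrier_mat n n" using A B by auto
  obtain u'' g'' c where c: "svd n (A - B) u'' g'' c" using svd_gram[OF C] by blast
  have ABC: "A = B + (A - B)" using A B by (intro eq_matI) auto
  have "N (real_diag n (\<lambda>i. \<bar>s i - s' i\<bar>)) \<le> N (real_diag n c)"
    by (rule uin_norm_dominance[OF N]) (use mirsky[OF A B C c ABC] in auto)
  then show ?thesis using uin_norm_abs[OF N] uin_norm_svd[OF N C c] by simp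
qed

text \<open>The matrix is Hermitian, so its Gramian is \<open>A * A\<close> with eigenvalues
  \<open>a i * a i\<close>, whose roots are absolute values; the sorting in \<open>sing_vals\<close>
  accounts for \<open>p\<close>.\<close>

lemma eigsys_sing_vals:
  assumes A: "A \<in> carrier_mat n n" and e: "eigsys n A g a"
  obtains p where "p permutes {..<n}" "sing_vals A = vec n (\<lambda>i. \<bar>a (p i)\<bar>)"
proof -
  define G where "G = mat_adjoint A * A"
  have G: "G \<in> carrier_mat n n" using A by (auto simp: G_def)
  have hG: "hermitian_mat G" unfolding G_def by (rule hermitian_gram)
  have "eigsys n G g (\<lambda>i. a i * a i)"
    unfolding eigsys_def
  proof (intro conjI allI impI)
    fix i assume i: "i < n"
    have gc: "g i \<in> carrier_vec n" using orthonormal_carrier[OF eigsys_onb[OF e] i] .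
    have "G *\<^sub>v g i = A *\<^sub>v (A *\<^sub>v g i)"
      using eigsys_hermitian[OF A e] assoc_mult_mat_vec[OF A A gc] by (simp add: G_def hermitian_mat_def)
    then show "G *\<^sub>v g i = of_real (a i * a i) \<cdot>\<^sub>v g i"
      using eigsys_mult[OF e i] mult_mat_vec[OF A gc] by (simp add: smult_smult_assoc)
  qed (rule eigsys_onb[OF e])
  then have "has_eigenvalues G (map (\<lambda>i. a i * a i) [0..<n])" by (rule has_eigenvalues_eigsys[OF G])
  then have "mset (map (\<lambda>i. a i * a i) [0..<n]) = mset (eigvals_desc G)"
    using has_eigenvalues_unique eigvals_desc_hermitian(1)[OF G hG] by blast
  moreover have len: "length (eigvals_desc G) = n" by (rule eigvals_desc_hermitian(3)[OF G hG])
  moreover have "map (\<lambda>i. eigvals_desc G ! i) [0..<n] = eigvals_desc G" using len by (metis map_nth)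
  ultimately obtain p where p: "p permutes {..<n}" "\<And>i. i < n \<Longrightarrow> eigvals_desc G ! i = a (p i) * a (p i)"
    using permutation_of_mset_eq[of "\<lambda>i. a i * a i" n "\<lambda>i. eigvals_desc G ! i"] by auto
  have "sing_vals A = vec n (\<lambda>i. \<bar>a (p i)\<bar>)"
    unfolding sing_vals_def G_def[symmetric] using len p(2)
    by (intro eq_vecI) (auto simp: vec_of_list_index)
  then show ?thesis using that p(1) by blast
qed

text \<open>Invariance of the gauge under permutations and sign changes undoes both the sorting and
  the absolute values in \<open>sing_vals\<close>.\<close>

lemma associated_gauge_eigsys:
  assumes N: "associated_gauge n N \<Phi>" and A: "A \<in> carrier_mat n n" and e: "eigsys n A g a"
  shows "N A = \<Phi> (vec n a)"
proof -
  obtain p where p: "p permutes {..<n}" "sing_vals A = vec n (\<lambda>i. \<bar>a (p i)\<bar>)"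
    by (rule eigsys_sing_vals[OF A e])
  have perm: "\<Phi> (vec n (\<lambda>i. x $ p i)) = \<Phi> x" if "x \<in> carrier_vec n" for x
    using N p(1) that unfolding associated_gauge_def symmetric_gauge_def by blast
  have sign: "\<Phi> (vec n (\<lambda>i. r i * x $ i)) = \<Phi> x"
    if "x \<in> carrier_vec n" "\<forall>i<n. r i \<in> {-1, 1}" for x and r :: "nat \<Rightarrow> real"
    using N that unfolding associated_gauge_def symmetric_gauge_def by blast
  have pn: "p i < n" if "i < n" for i using permutes_in_image[OF p(1), of i] that by simp
  have "N A = \<Phi> (vec n (\<lambda>i. \<bar>a (p i)\<bar>))"
    using N A p(2) by (simp add: associated_gauge_def)
  also have "vec n (\<lambda>i. \<bar>a (p i)\<bar>) = vec n (\<lambda>i. vec n (\<lambda>i. \<bar>a i\<bar>) $ p i)"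
    using pn by (intro eq_vecI) auto
  also have "\<Phi> \<dots> = \<Phi> (vec n (\<lambda>i. \<bar>a i\<bar>))" by (rule perm) simp
  also have "vec n (\<lambda>i. \<bar>a i\<bar>) = vec n (\<lambda>i. (if 0 \<le> a i then 1 else -1) * vec n a $ i)"
    by (intro eq_vecI) auto
  also have "\<Phi> \<dots> = \<Phi> (vec n a)" by (rule sign) auto
  finally show ?thesis .
qed

section \<open>Frames and coisometries\<close>

lemma vnorm_square: "v \<in> carrier_vec n \<Longrightarrow> (vnorm v)\<^sup>2 = Re (v \<bullet>c v)"
  by (simp add: vnorm_def cscalar_prod_self[of _ n] sum_nonneg del: of_real_sum)

lemma synthesis_carrier: "length fs = m \<Longrightarrow> synthesis n fs \<in> carrier_mat n m"
  by (auto simp: synthesis_def)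

text \<open>The coordinates of the adjoint applied to \<open>f\<close> are the frame coefficients of
  \<open>f\<close>, so frame bounds become bounds on a norm.\<close>

lemma analysis_norm:
  assumes fs: "set fs \<subseteq> carrier_vec n" and f: "f \<in> carrier_vec n"
  shows "(\<Sum>i<length fs. (cmod (f \<bullet>c (fs ! i)))\<^sup>2)
    = Re ((mat_adjoint (synthesis n fs) *\<^sub>v f) \<bullet>c (mat_adjoint (synthesis n fs) *\<^sub>v f))"
proof -
  have F: "synthesis n fs \<in> carrier_mat n (length fs)" by (rule synthesis_carrier) simp
  have "(mat_adjoint (synthesis n fs) *\<^sub>v f) $ i = f \<bullet>c (fs ! i)" if i: "i < length fs" for i
  proof -
    have "fs ! i \<in> carrier_vec n" using fs i nth_mem by blast
    then show ?thesis using F f i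
      by (simp add: cscalar_prod_eq_sum[of _ n] scalar_prod_def atLeast0LessThan mult.commute)
        (simp add: synthesis_def mat_of_cols_index)
  qed
  then show ?thesis
    using cscalar_prod_self[OF adjoint_mult_vec_carrier[OF F, of f]] by simp
qed

lemma gram_prod:
  fixes A :: "complex mat"
  assumes A: "A \<in> carrier_mat p q" and z: "z \<in> carrier_vec q" and w: "w \<in> carrier_vec q"
  shows "((mat_adjoint A * A) *\<^sub>v z) \<bullet>c w = (A *\<^sub>v z) \<bullet>c (A *\<^sub>v w)"
  using cscalar_prod_adjoint[OF mat_adjoint_carrier[OF A] _ w, of "A *\<^sub>v z"] A z
    assoc_mult_mat_vec[OF mat_adjoint_carrier[OF A] A z] by simp

lemma coisometry_adjoint_prod:
  fixes X :: "complex mat"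
  assumes X: "X \<in> carrier_mat n m" and XX: "X * mat_adjoint X = 1\<^sub>m n"
    and z: "z \<in> carrier_vec n"
  shows "(mat_adjoint X *\<^sub>v z) \<bullet>c (mat_adjoint X *\<^sub>v z) = z \<bullet>c z"
  using gram_prod[OF mat_adjoint_carrier[OF X] z z] XX z by simp

text \<open>The Parseval identity fixes only the quadratic form of \<open>X * mat_adjoint X\<close>.
  Evaluated on an orthonormal eigenbasis it forces every eigenvalue to be 1, which takes the place
  of polarization.\<close>

lemma parseval_frame_coisometry:
  assumes pf: "is_parseval_frame n xs"
  shows "synthesis n xs * mat_adjoint (synthesis n xs) = 1\<^sub>m n"
proof -
  define X where "X = synthesis n xs"
  define H where "H = X * mat_adjoint X"
  have X: "X \<in> carrier_mat n (length xs)" unfolding X_def by (rule synthesis_carrier) simp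
  have H: "H \<in> carrier_mat n n" using X by (auto simp: H_def intro: mult_carrier_mat)
  have "hermitian_mat H" using hermitian_gram[of "mat_adjoint X"] by (simp add: H_def)
  then obtain g a where e: "eigsys n H g a" using spectral_theorem_desc[OF H] by blast
  show ?thesis
    unfolding X_def[symmetric] H_def[symmetric]
  proof (rule mat_eqI_onb[OF eigsys_onb[OF e] H])
    fix i assume i: "i < n"
    have gc: "g i \<in> carrier_vec n" using orthonormal_carrier[OF eigsys_onb[OF e] i] .
    have gg: "g i \<bullet>c g i = 1" using orthonormal_prod[OF eigsys_onb[OF e] i i] by simp
    have "(vnorm (g i))\<^sup>2 = (\<Sum>j<length xs. (cmod (g i \<bullet>c (xs ! j)))\<^sup>2)"
      using pf gc unfolding is_parseval_frame_def frame_bounds_def by force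
    then have "Re (g i \<bullet>c g i) = Re ((mat_adjoint X *\<^sub>v g i) \<bullet>c (mat_adjoint X *\<^sub>v g i))"
      using pf gc analysis_norm[of xs n "g i"] vnorm_square[OF gc]
      by (simp add: is_parseval_frame_def X_def)
    also have "\<dots> = Re ((H *\<^sub>v g i) \<bullet>c g i)"
      using gram_prod[OF mat_adjoint_carrier[OF X] gc gc] by (simp add: H_def)
    also have "\<dots> = a i"
      using eigsys_mult[OF e i] gg by (simp add: cscalar_prod_smult_left[OF gc gc])
    finally have "a i = 1" using gg by simp
    then show "H *\<^sub>v g i = 1\<^sub>m n *\<^sub>v g i" using eigsys_mult[OF e i] gc by simp
  qed simp
qed

lemma coisometry_parseval_frame:
  fixes X :: "complex mat"
  assumes X: "X \<in> carrier_mat n m" and XX: "X * mat_adjoint X = 1\<^sub>m n"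
  shows "length (cols X) = m" "is_parseval_frame n (cols X)" "synthesis n (cols X) = X"
proof -
  show "length (cols X) = m" using X by simp
  have s: "set (cols X) \<subseteq> carrier_vec n" using X cols_dim by blast
  show syn: "synthesis n (cols X) = X" using X mat_of_cols_cols[of X] by (simp add: synthesis_def)
  have "(\<Sum>i<length (cols X). (cmod (f \<bullet>c (cols X ! i)))\<^sup>2) = (vnorm f)\<^sup>2"
    if f: "f \<in> carrier_vec n" for f
    using analysis_norm[OF s f] coisometry_adjoint_prod[OF X XX f] vnorm_square[OF f] syn by simp
  then show "is_parseval_frame n (cols X)"
    unfolding is_parseval_frame_def frame_bounds_def using s by simp
qed

lemma eigsys_minus_one:
  assumes A: "A \<in> carrier_mat n n" and e: "eigsys n A g a"
  shows "eigsys n (A - 1\<^sub>m n) g (\<lambda>i. a i - 1)"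
  unfolding eigsys_def
proof (intro conjI allI impI)
  fix i assume i: "i < n"
  have gc: "g i \<in> carrier_vec n" using orthonormal_carrier[OF eigsys_onb[OF e] i] .
  show "(A - 1\<^sub>m n) *\<^sub>v g i = of_real (a i - 1) \<cdot>\<^sub>v g i"
    unfolding minus_mult_distrib_mat_vec[OF A one_carrier_mat gc] eigsys_mult[OF e i]
    using gc by (intro eq_vecI) (auto simp: algebra_simps)
qed (rule eigsys_onb[OF e])

lemma svd_one: "svd n (1\<^sub>m n) (unit_vec n) (unit_vec n) (\<lambda>_. 1)"
proof -
  have "mat_adjoint (1\<^sub>m n) = (1\<^sub>m n :: complex mat)"
    by (rule eq_matI) auto
  then show ?thesis by (simp add: svd_def onb_unit_vec desc_def)
qed

section \<open>Singular value decomposition of the synthesis operator of a frame\<close>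

locale frame_spectrum =
  fixes n m :: nat and fs :: "complex vec list" and F :: "complex mat"
    and lam :: "nat \<Rightarrow> real" and g :: "nat \<Rightarrow> complex vec"
  assumes frame: "is_frame n fs" and len: "length fs = m" and F_def: "F = synthesis n fs"
    and lam: "eigsys m (mat_adjoint F * F) g lam" "desc m lam"
begin

lemma F: "F \<in> carrier_mat n m"
  unfolding F_def by (rule synthesis_carrier[OF len])

lemma onb_g: "onb m g"
  by (rule eigsys_onb[OF lam(1)])

lemma g_carrier: "i < m \<Longrightarrow> g i \<in> carrier_vec m"
  using orthonormal_carrier[OF onb_g] .

text \<open>Orthogonality to the images of a basis means that the adjoint of \<open>F\<close> kills
  \<open>f\<close>, which the positive lower frame bound permits only for zero.\<close>

lemma analysis_injective:
  assumes f: "f \<in> carrier_vec n" and orth: "\<And>i. i < m \<Longrightarrow> f \<bullet>c (F *\<^sub>v g i) = 0"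
  shows "f = 0\<^sub>v n"
proof (rule ccontr)
  assume "f \<noteq> 0\<^sub>v n"
  have "mat_adjoint F *\<^sub>v f = 0\<^sub>v m"
  proof (rule onb_vec_eqI[OF onb_g])
    fix i assume i: "i < m"
    show "(mat_adjoint F *\<^sub>v f) \<bullet>c g i = 0\<^sub>v m \<bullet>c g i"
      using cscalar_prod_adjoint[OF mat_adjoint_carrier[OF F] f g_carrier[OF i]] orth[OF i]
        g_carrier[OF i] by (simp add: cscalar_prod_eq_sum[of _ m])
  qed (use F in auto)
  then have "Re ((mat_adjoint F *\<^sub>v f) \<bullet>c (mat_adjoint F *\<^sub>v f)) = 0" by simp
  moreover obtain A where "0 < A"
    "A * (vnorm f)\<^sup>2 \<le> (\<Sum>i<length fs. (cmod (f \<bullet>c (fs ! i)))\<^sup>2)"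
    using frame f unfolding is_frame_def frame_bounds_def by blast
  moreover have "set fs \<subseteq> carrier_vec n" using frame by (simp add: is_frame_def)
  moreover have "0 < Re (f \<bullet>c f)" using cscalar_prod_self_pos[OF f \<open>f \<noteq> 0\<^sub>v n\<close>] .
  ultimately show False
    using analysis_norm[of fs n f] f vnorm_square[OF f] by (auto simp: F_def mult_le_0_iff)
qed

lemma lam_nonneg: "i < m \<Longrightarrow> 0 \<le> lam i"
  using gram_eigenvalue_nonneg[OF F lam(1)] .

text \<open>With \<open>m < n\<close> some nonzero vector would be orthogonal to all
  \<open>m\<close> images, against injectivity of the analysis operator.\<close>

lemma n_le_m: "n \<le> m"
proof (rule ccontr)
  assume "\<not> n \<le> m"
  then obtain f where "f \<in> carrier_vec n" "f \<noteq> 0\<^sub>v n" "\<And>i. i < m \<Longrightarrow> f \<bullet>c (F *\<^sub>v g i) = 0"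
    using exists_orthogonal_vec[of "map (\<lambda>i. F *\<^sub>v g i) [0..<m]" n] F g_carrier
    by (auto simp: image_subset_iff)
  then show False using analysis_injective by blast
qed

text \<open>If positivity fails at \<open>i\<close>, all images from \<open>i\<close> on vanish, and
  the fewer than \<open>n\<close> earlier ones leave room for a nonzero orthogonal vector.\<close>

lemma lam_pos: "0 < lam i" if i: "i < n"
proof (rule ccontr)
  assume "\<not> 0 < lam i"
  have zero: "F *\<^sub>v g l = 0\<^sub>v n" if l: "i \<le> l" "l < m" for l
  proof -
    have "lam l = 0" using descD[OF lam(2) l] \<open>\<not> 0 < lam i\<close> lam_nonneg[OF l(2)] by simp
    then show ?thesis by (rule gram_eigenvalue_zero[OF F lam(1) l(2)])
  qed
  have "i < m" using i n_le_m by simp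
  then obtain f where f: "f \<in> carrier_vec n" "f \<noteq> 0\<^sub>v n" "\<And>l. l < i \<Longrightarrow> f \<bullet>c (F *\<^sub>v g l) = 0"
    using exists_orthogonal_vec[of "map (\<lambda>l. F *\<^sub>v g l) [0..<i]" n] F g_carrier i
    by (auto simp: image_subset_iff)
  have "f \<bullet>c (F *\<^sub>v g l) = 0" if "l < m" for l
    using f(1,3) zero that by (cases "l < i") (simp_all add: cscalar_prod_eq_sum[of _ n])
  then show False using analysis_injective f by blast
qed

definition u :: "nat \<Rightarrow> complex vec" where "u = left_vec F g lam"

text \<open>The first \<open>n\<close> eigenvalues are positive, so their left vectors alone fill
  the space and no completion takes place.\<close>

lemma onb_u: "onb n u"
  unfolding u_def by (rule orthonormal_left_vec[OF F lam(1) n_le_m lam_pos])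

lemma F_g: "i < n \<Longrightarrow> F *\<^sub>v g i = of_real (sqrt (lam i)) \<cdot>\<^sub>v u i"
  unfolding u_def using n_le_m by (intro left_vec(2)[OF F lam(1)] lam_pos) auto

text \<open>The adjoint sends each \<open>u j\<close> to a multiple of \<open>g j\<close>, which is
  orthogonal to \<open>g i\<close>. These \<open>m - n\<close> kernel vectors are the stock for the
  rotations.\<close>

lemma F_g_zero: "F *\<^sub>v g i = 0\<^sub>v n" if i: "n \<le> i" "i < m"
proof (rule onb_vec_eqI[OF onb_u])
  fix j assume j: "j < n"
  have jm: "j < m" using j n_le_m by simp
  have uc: "u j \<in> carrier_vec n" using orthonormal_carrier[OF onb_u j] .
  have "(F *\<^sub>v g i) \<bullet>c u j = g i \<bullet>c (of_real (sqrt (lam j)) \<cdot>\<^sub>v g j)"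
    using cscalar_prod_adjoint[OF F g_carrier[OF i(2)] uc] left_vec(3)[OF F lam(1) jm lam_pos[OF j]]
    by (simp add: u_def)
  also have "\<dots> = 0"
    using g_carrier[OF i(2)] g_carrier[OF jm] orthonormal_prod[OF onb_g i(2) jm] i j
    by (simp add: cscalar_prod_smult_right[of _ m])
  finally show "(F *\<^sub>v g i) \<bullet>c u j = 0\<^sub>v n \<bullet>c u j"
    using uc by (simp add: cscalar_prod_eq_sum[of _ n])
qed (use F g_carrier i in auto)

section \<open>An optimal Parseval frame\<close>

text \<open>The adjoint of \<open>X\<close> maps the left singular vectors of \<open>F\<close> to the right singular
  vectors \<open>g\<^sub>i\<close> of \<open>F\<close>, except that for \<open>i < r\<close> the unit vector \<open>c\<^sub>i g\<^sub>i + s\<^sub>i g\<^bsub>n+i\<^esub>\<close> with \<open>F g\<^bsub>n+i\<^esub> = 0\<close> lowers the singular value to \<open>1\<close>.\<close>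

lemma exists_coisometry:
  assumes r: "r \<le> n" "r \<le> m - n" and one: "\<And>i. i < r \<Longrightarrow> 1 \<le> lam i"
  shows "\<exists>X. X \<in> carrier_mat n m \<and> X * mat_adjoint X = 1\<^sub>m n \<and>
    eigsys n (F * mat_adjoint X) u (\<lambda>i. if i < r then 1 else sqrt (lam i))"
proof -
  \<comment> \<open>Cosine and sine of the rotation: \<open>c i\<close> brings the length
    \<open>sqrt (lam i)\<close> of the image down to 1, and \<open>1 \<le> lam i\<close> makes the
    radicand in \<open>s i\<close> nonnegative.\<close>
  define c where "c i = 1 / sqrt (lam i)" for i
  define s where "s i = sqrt (1 - 1 / lam i)" for i
  define y where "y i = (if i < r
      then of_real (c i) \<cdot>\<^sub>v g i + of_real (s i) \<cdot>\<^sub>v g (n + i) else g i)" for i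
  have rm: "n + i < m" if "i < r" for i using that r by simp
  have nm: "i < m" if "i < n" for i using that n_le_m by simp
  have yc: "y i \<in> carrier_vec m" if "i < n" for i
    using that g_carrier nm rm by (simp add: y_def)
  have cs: "c i * c i + s i * s i = 1" if "i < r" for i
    using one[OF that] by (simp add: c_def s_def)
  have cl: "c i * sqrt (lam i) = 1" if "i < r" for i
    using one[OF that] by (simp add: c_def)
  have add_left: "(v + w) \<bullet>c x = v \<bullet>c x + w \<bullet>c x"
    and add_right: "x \<bullet>c (v + w) = x \<bullet>c v + x \<bullet>c w"
    if "v \<in> carrier_vec m" "w \<in> carrier_vec m" "x \<in> carrier_vec m" for v w x :: "complex vec"
    using that by (simp_all add: cscalar_prod_eq_sum[of _ m] sum.distrib distrib_left distrib_right)
  have gp: "g i \<bullet>c g j = (if i = j then 1 else 0)" if "i < m" "j < m" for i j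
    using orthonormal_prod[OF onb_g] that by blast
  \<comment> \<open>Different rotations use different kernel vectors \<open>g (n + i)\<close>, none
    of which is among the first \<open>n\<close> basis vectors.\<close>
  have ortho: "y i \<bullet>c y j = (if i = j then 1 else 0)" if i: "i < n" and j: "j < n" for i j
  proof -
    have cs': "complex_of_real (c i) * of_real (c i) + of_real (s i) * of_real (s i) = 1" if "i < r"
      using cs[OF that] by (metis of_real_1 of_real_add of_real_mult)
    show ?thesis
      using i j nm[OF i] nm[OF j] rm[of i] rm[of j] cs'
      by (auto simp: y_def g_carrier add_left add_right cscalar_prod_smult_left[of _ m]
          cscalar_prod_smult_right[of _ m] gp)
  qed
  have Fy: "F *\<^sub>v y i = of_real (if i < r then 1 else sqrt (lam i)) \<cdot>\<^sub>v u i" if i: "i < n" for i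
  proof (cases "i < r")
    case True
    have uc: "u i \<in> carrier_vec n" using orthonormal_carrier[OF onb_u i] .
    have gc: "g i \<in> carrier_vec m" "g (n + i) \<in> carrier_vec m"
      using g_carrier nm[OF i] rm[OF True] by auto
    have cl': "complex_of_real (c i) * of_real (sqrt (lam i)) = 1"
      using cl[OF True] by (metis of_real_1 of_real_mult)
    have "F *\<^sub>v y i = of_real (c i) \<cdot>\<^sub>v (F *\<^sub>v g i) + of_real (s i) \<cdot>\<^sub>v (F *\<^sub>v g (n + i))"
      using True gc by (simp add: y_def mult_add_distrib_mat_vec[OF F] mult_mat_vec[OF F])
    also have "\<dots> = u i"
      unfolding F_g[OF i] F_g_zero[OF _ rm[OF True], simplified] smult_smult_assoc cl'
      using uc by (intro eq_vecI) auto
    finally show ?thesis using True by simp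
  next
    case False
    then show ?thesis using F_g[OF i] by (simp add: y_def)
  qed
  \<comment> \<open>The sum of the rank-one matrices formed from \<open>y i\<close> and the adjoint
    of \<open>u i\<close>, hence the isometry taking \<open>u i\<close> to \<open>y i\<close>; it
    serves as the adjoint of \<open>X\<close>.\<close>
  define W where "W = mat m n (\<lambda>(k, l). \<Sum>i<n. y i $ k * cnj (u i $ l))"
  have W: "W \<in> carrier_mat m n" by (simp add: W_def)
  have Wu: "W *\<^sub>v u j = y j" if j: "j < n" for j
  proof (rule eq_vecI)
    fix k assume "k < dim_vec (y j)"
    then have k: "k < m" using yc[OF j] by simp
    have uc: "u j \<in> carrier_vec n" using orthonormal_carrier[OF onb_u j] .
    have "(W *\<^sub>v u j) $ k = (\<Sum>l<n. \<Sum>i<n. y i $ k * (u j $ l * cnj (u i $ l)))"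
      using k uc by (simp add: W_def scalar_prod_def atLeast0LessThan sum_distrib_left mult_ac)
    also have "\<dots> = (\<Sum>i<n. y i $ k * (\<Sum>l<n. u j $ l * cnj (u i $ l)))"
      by (subst sum.swap) (simp add: sum_distrib_left)
    also have "\<dots> = (\<Sum>i<n. if i = j then y i $ k else 0)"
    proof (intro sum.cong refl)
      fix i assume "i \<in> {..<n}"
      then have i: "i < n" by simp
      show "y i $ k * (\<Sum>l<n. u j $ l * cnj (u i $ l)) = (if i = j then y i $ k else 0)"
        using cscalar_prod_eq_sum[OF uc orthonormal_carrier[OF onb_u i]]
          orthonormal_prod[OF onb_u j i] by auto
    qed
    finally show "(W *\<^sub>v u j) $ k = y j $ k" using j by simp
  qed (use W yc[OF j] in auto)
  have WW: "mat_adjoint W * W = 1\<^sub>m n"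
  proof (rule mat_eqI_onb[OF onb_u])
    show "mat_adjoint W * W \<in> carrier_mat n n"
      using mult_carrier_mat[OF mat_adjoint_carrier[OF W] W] .
    fix i assume i: "i < n"
    have uc: "u i \<in> carrier_vec n" using orthonormal_carrier[OF onb_u i] .
    have "(mat_adjoint W * W) *\<^sub>v u i = u i"
    proof (rule onb_vec_eqI[OF onb_u])
      fix j assume j: "j < n"
      show "((mat_adjoint W * W) *\<^sub>v u i) \<bullet>c u j = u i \<bullet>c u j"
        using gram_prod[OF W uc orthonormal_carrier[OF onb_u j]] Wu i j ortho[OF i j]
          orthonormal_prod[OF onb_u i j] by simp
    qed (use W uc in \<open>auto intro!: carrier_vecI\<close>)
    then show "(mat_adjoint W * W) *\<^sub>v u i = 1\<^sub>m n *\<^sub>v u i" using uc by simp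
  qed simp
  have "eigsys n (F * W) u (\<lambda>i. if i < r then 1 else sqrt (lam i))"
    unfolding eigsys_def
  proof (intro conjI allI impI)
    fix i assume i: "i < n"
    show "(F * W) *\<^sub>v u i = of_real (if i < r then 1 else sqrt (lam i)) \<cdot>\<^sub>v u i"
      using assoc_mult_mat_vec[OF F W orthonormal_carrier[OF onb_u i]] Wu[OF i] Fy[OF i] by simp
  qed (rule onb_u)
  then show ?thesis
    using W WW by (intro exI[of _ "mat_adjoint W"]) simp
qed

section \<open>Attainment and lower bound for the values \<open>d\<close>\<close>

abbreviation d :: "nat \<Rightarrow> real" where
  "d j \<equiv> (if 1 \<le> lam (m - n + j) then lam (m - n + j) else if 1 \<le> lam j then 1 else lam j)"

lemma d_pos: "j < n \<Longrightarrow> 0 < d j"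
  using lam_pos[of j] by auto

text \<open>Rotating as many vectors as the kernel permits, beginning with the largest eigenvalues,
  produces the numbers \<open>sqrt (d j)\<close> in a different order; a permutation of the
  eigenbasis repairs this.\<close>

lemma exists_optimal_coisometry:
  "\<exists>X w. X \<in> carrier_mat n m \<and> X * mat_adjoint X = 1\<^sub>m n \<and>
    eigsys n (F * mat_adjoint X) w (\<lambda>j. sqrt (d j))"
proof -
  obtain p where p: "p \<le> m" "\<And>i. i < m \<Longrightarrow> 1 \<le> lam i \<longleftrightarrow> i < p"
    using downward_closed_threshold[of m "\<lambda>i. 1 \<le> lam i"] descD[OF lam(2)] by (metis order_trans)
  \<comment> \<open>For \<open>n < m\<close> the eigenvalue at index \<open>n\<close> belongs to a
    kernel vector, so it is 0 and below the threshold.\<close>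
  have pn: "p \<le> n"
  proof (rule ccontr)
    assume "\<not> p \<le> n"
    then have "n < m" "1 \<le> lam n" using p by auto
    then show False
      using F_g_zero[of n] gram_eigenvectors_prod[OF F lam(1), of n n] by simp
  qed
  \<comment> \<open>The number of indices \<open>j\<close> with
    \<open>1 \<le> lam (m - n + j)\<close>. Truncated subtraction makes it 0 when the kernel has
    room for all \<open>p\<close> rotations, so \<open>r\<close> is the smaller of \<open>p\<close>
    and \<open>m - n\<close>.\<close>
  define q where "q = p - (m - n)"
  define r where "r = p - q"
  have r: "r \<le> n" "r \<le> m - n" "\<And>i. i < r \<Longrightarrow> 1 \<le> lam i"
    using p pn by (auto simp: r_def q_def)
  obtain X where X: "X \<in> carrier_mat n m" "X * mat_adjoint X = 1\<^sub>m n"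
    and e: "eigsys n (F * mat_adjoint X) u (\<lambda>i. if i < r then 1 else sqrt (lam i))"
    using exists_coisometry[OF r] by blast
  \<comment> \<open>The first \<open>q\<close> positions take the large values left unrotated, which
    start at index \<open>m - n\<close> since \<open>r = m - n\<close> whenever \<open>q\<close> is
    positive; the next \<open>r\<close> positions take the ones; from \<open>p\<close> on nothing
    moves.\<close>
  define h where "h j = (if j < q then m - n + j else if j < p then j - q else j)" for j
  have hn: "h j < n" if "j < n" for j
    using that n_le_m pn p(1) by (auto simp: h_def q_def)
  have "inj_on h {..<n}"
    using n_le_m pn p(1) by (intro inj_onI) (auto simp: h_def q_def split: if_splits)
  moreover have "h ` {..<n} \<subseteq> {..<n}" using hn by auto
  ultimately have "bij_betw h {..<n} {..<n}"
    by (simp add: bij_betw_def endo_inj_surj)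
  moreover have "h j = j" if "j \<notin> {..<n}" for j
    using that pn by (auto simp: h_def q_def)
  ultimately have h: "h permutes {..<n}" by (rule bij_imp_permutes)
  have val: "(if h j < r then 1 else sqrt (lam (h j))) = sqrt (d j)" if j: "j < n" for j
  proof -
    have m: "m - n + j < m" "j < m" using j n_le_m by auto
    consider "j < q" | "q \<le> j" "j < p" | "p \<le> j" by linarith
    then show ?thesis
    proof cases
      case 1
      then have "m - n + j < p" "\<not> h j < r" "h j = m - n + j" by (auto simp: q_def r_def h_def)
      then show ?thesis using p(2)[OF m(1)] by simp
    next
      case 2
      then have "\<not> m - n + j < p" "h j < r" using pn by (auto simp: q_def r_def h_def)
      then show ?thesis using p(2)[OF m(1)] p(2)[OF m(2)] 2 by simp
    next
      case 3
      then have "\<not> m - n + j < p" "\<not> h j < r" "h j = j" by (auto simp: q_def r_def h_def)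
      then show ?thesis using p(2)[OF m(1)] p(2)[OF m(2)] 3 by simp
    qed
  qed
  have "eigsys n (F * mat_adjoint X) (\<lambda>j. u (h j)) (\<lambda>j. sqrt (d j))"
    unfolding eigsys_def
  proof (intro conjI allI impI)
    fix j assume j: "j < n"
    show "(F * mat_adjoint X) *\<^sub>v u (h j) = of_real (sqrt (d j)) \<cdot>\<^sub>v u (h j)"
      using eigsys_mult[OF e hn[OF j]] unfolding val[OF j] .
  qed (rule onb_permute[OF onb_u h])
  then show ?thesis using X by blast
qed

text \<open>The Gramian of \<open>A\<close> is the compression of the Gramian of \<open>F\<close> by
  the isometry \<open>mat_adjoint X\<close>. Both bounds are \<open>weyl_inequality\<close> with
  \<open>t = 0\<close>, the roles of the two Gramians being exchanged; each time there are
  \<open>n - 1\<close> orthogonality conditions in dimension \<open>n\<close>.\<close>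

lemma interlacing:
  assumes X: "X \<in> carrier_mat n m" and XX: "X * mat_adjoint X = 1\<^sub>m n"
    and A: "A = F * mat_adjoint X"
    and e: "eigsys n (mat_adjoint A * A) h b" "desc n b" and j: "j < n"
  shows "b j \<le> lam j" "lam (m - n + j) \<le> b j"
proof -
  have FF: "mat_adjoint F * F \<in> carrier_mat m m"
    using mult_carrier_mat[OF mat_adjoint_carrier[OF F] F] .
  have Ac: "A \<in> carrier_mat n n" unfolding A using mult_carrier_mat[OF F mat_adjoint_carrier[OF X]] .
  then have AA: "mat_adjoint A * A \<in> carrier_mat n n" by auto
  have X': "mat_adjoint X \<in> carrier_mat m n" using X by auto
  have form: "((mat_adjoint A * A) *\<^sub>v z) \<bullet>c z
      = ((mat_adjoint F * F) *\<^sub>v (mat_adjoint X *\<^sub>v z)) \<bullet>c (mat_adjoint X *\<^sub>v z)"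
    if z: "z \<in> carrier_vec n" for z
  proof -
    have Xz: "mat_adjoint X *\<^sub>v z \<in> carrier_vec m" using X by simp
    show ?thesis
      using gram_prod[OF Ac z z] gram_prod[OF F Xz Xz] assoc_mult_mat_vec[OF F X' z] by (simp add: A)
  qed
  have "b j \<le> lam j + 0"
    by (rule weyl_inequality[OF AA e FF lam one_carrier_mat X'])
      (use form coisometry_adjoint_prod[OF X XX] j n_le_m in auto)
  then show "b j \<le> lam j" by simp
  have "lam (m - n + j) \<le> b j + 0"
    by (rule weyl_inequality[OF FF lam AA e X' one_carrier_mat])
      (use form coisometry_adjoint_prod[OF X XX] j n_le_m in auto)
  then show "lam (m - n + j) \<le> b j" by simp
qed

lemma uin_norm_lower_bound:
  assumes N: "unitarily_invariant_norm n N"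
    and X: "X \<in> carrier_mat n m" and XX: "X * mat_adjoint X = 1\<^sub>m n"
  shows "N (real_diag n (\<lambda>j. sqrt (d j) - 1)) \<le> N (F * mat_adjoint X - 1\<^sub>m n)"
proof -
  define A where "A = F * mat_adjoint X"
  have A: "A \<in> carrier_mat n n" unfolding A_def using mult_carrier_mat[OF F mat_adjoint_carrier[OF X]] .
  then have AA: "mat_adjoint A * A \<in> carrier_mat n n" by auto
  define b where "b i = eigvals_desc (mat_adjoint A * A) ! i" for i
  obtain h where h: "eigsys n (mat_adjoint A * A) h b" and b: "desc n b"
    using spectral_theorem_desc[OF AA hermitian_gram] unfolding b_def by blast
  obtain v where v: "svd n A v h (\<lambda>i. sqrt (b i))" using svd_exists[OF A h b] by blast
  \<comment> \<open>The square root is monotone and fixes 1, so it preserves the nearest point to 1: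
    either \<open>1 \<le> d j \<le> b j\<close>, or \<open>d j = 1\<close>, or
    \<open>b j \<le> d j < 1\<close>.\<close>
  have "\<bar>sqrt (d j) - 1\<bar> \<le> \<bar>sqrt (b j) - 1\<bar>" if j: "j < n" for j
  proof -
    have "b j \<le> lam j" "lam (m - n + j) \<le> b j"
      using interlacing[OF X XX A_def h b j] by auto
    moreover have "1 \<le> sqrt t" if "1 \<le> t" for t :: real using that by simp
    moreover have "sqrt t \<le> 1" if "t \<le> 1" for t :: real using that by simp
    moreover have "sqrt t \<le> sqrt t'" if "t \<le> t'" for t t' :: real using that by simp
    ultimately show ?thesis by (smt (verit))
  qed
  then have "N (real_diag n (\<lambda>j. sqrt (d j) - 1)) \<le> N (real_diag n (\<lambda>j. \<bar>sqrt (b j) - 1\<bar>))"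
    by (rule uin_norm_mono[OF N])
  also have "\<dots> = N (real_diag n (\<lambda>j. sqrt (b j) - 1))" by (rule uin_norm_abs[OF N])
  \<comment> \<open>All singular values of the identity are 1, so Mirsky's inequality compares with
    the differences \<open>sqrt (b j) - 1\<close>.\<close>
  also have "\<dots> \<le> N (A - 1\<^sub>m n)" by (rule uin_norm_mirsky[OF N A v one_carrier_mat svd_one])
  finally show ?thesis by (simp add: A_def)
qed

end

theorem theorem7:
  fixes n m :: nat and fs :: "complex vec list" and F :: "complex mat"
    and lam :: "real list" and d :: "nat \<Rightarrow> real"
  assumes "is_frame n fs" and "length fs = m"
    and "F = synthesis n fs"
    and "lam = eigvals_desc (mat_adjoint F * F)"
    and "d = d_seq n m lam"
  shows "(\<forall>j<n. 0 < d j) \<and>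
    (\<exists>xs. length xs = m \<and> is_parseval_frame n xs \<and>
        psd n (F * mat_adjoint (synthesis n xs)) \<and>
        has_eigenvalues (F * mat_adjoint (synthesis n xs)) (map (\<lambda>j. sqrt (d j)) [0..<n])) \<and>
    (\<forall>xs. length xs = m \<and> is_parseval_frame n xs \<and>
        psd n (F * mat_adjoint (synthesis n xs)) \<and>
        has_eigenvalues (F * mat_adjoint (synthesis n xs)) (map (\<lambda>j. sqrt (d j)) [0..<n]) \<longrightarrow>
      (\<forall>N. unitarily_invariant_norm n N \<longrightarrow>
        (\<forall>ys. length ys = m \<and> is_parseval_frame n ys \<longrightarrow>
          N (F * mat_adjoint (synthesis n xs) - 1\<^sub>m n)
            \<le> N (F * mat_adjoint (synthesis n ys) - 1\<^sub>m n)))) \<and>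
    (\<forall>N \<Phi>. unitarily_invariant_norm n N \<and> associated_gauge n N \<Phi> \<longrightarrow>
        alpha n N fs \<in> parseval_errors n m N F \<and>
        alpha n N fs = \<Phi> (vec n (\<lambda>j. 1 - sqrt (d j))))"
proof -
  have F: "F \<in> carrier_mat n m" using assms(2,3) synthesis_carrier by blast
  have FF: "mat_adjoint F * F \<in> carrier_mat m m"
    using mult_carrier_mat[OF mat_adjoint_carrier[OF F] F] .
  obtain g where "eigsys m (mat_adjoint F * F) g (\<lambda>i. lam ! i)" "desc m (\<lambda>i. lam ! i)"
    using spectral_theorem_desc[OF FF hermitian_gram] unfolding assms(4) by blast
  then interpret frame_spectrum n m fs F "\<lambda>i. lam ! i" g
    using assms by unfold_locales auto
  have d: "d = (\<lambda>j. if 1 \<le> lam ! (m - n + j) then lam ! (m - n + j) else if 1 \<le> lam ! j then 1 else lam ! j)"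
    unfolding assms(5) by (auto simp: d_seq_def)
  have syn: "synthesis n xs \<in> carrier_mat n m" if "length xs = m" for xs
    using that by (rule synthesis_carrier)
  have prod: "F * mat_adjoint X \<in> carrier_mat n n" if "X \<in> carrier_mat n m" for X
    using mult_carrier_mat[OF F mat_adjoint_carrier[OF that]] .
  have bound: "N (real_diag n (\<lambda>j. sqrt (d j) - 1)) \<le> N (F * mat_adjoint X - 1\<^sub>m n)"
    if "unitarily_invariant_norm n N" "X \<in> carrier_mat n m" "X * mat_adjoint X = 1\<^sub>m n" for N X
    using uin_norm_lower_bound[OF that] unfolding d .
  obtain X w where X: "X \<in> carrier_mat n m" "X * mat_adjoint X = 1\<^sub>m n"
    and e: "eigsys n (F * mat_adjoint X) w (\<lambda>j. sqrt (d j))"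
    using exists_optimal_coisometry unfolding d by blast
  have e1: "eigsys n (F * mat_adjoint X - 1\<^sub>m n) w (\<lambda>j. sqrt (d j) - 1)"
    by (rule eigsys_minus_one[OF prod[OF X(1)] e])
  have c1: "F * mat_adjoint Y - 1\<^sub>m n \<in> carrier_mat n n" if "Y \<in> carrier_mat n m" for Y
    using prod[OF that] by auto
  have pos: "0 < d j" if "j < n" for j using d_pos[OF that] unfolding d .
  have "psd n (F * mat_adjoint X)"
    unfolding psd_def
    using prod[OF X(1)] eigsys_hermitian[OF prod[OF X(1)] e] pos
      eigsys_quadratic_form[OF prod[OF X(1)] e]
    by (auto intro!: sum_nonneg mult_nonneg_nonneg simp: less_imp_le)
  then have item1: "\<exists>xs. length xs = m \<and> is_parseval_frame n xs \<and>
      psd n (F * mat_adjoint (synthesis n xs)) \<and>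
      has_eigenvalues (F * mat_adjoint (synthesis n xs)) (map (\<lambda>j. sqrt (d j)) [0..<n])"
    using coisometry_parseval_frame[OF X] has_eigenvalues_eigsys[OF prod[OF X(1)] e]
    by (intro exI[of _ "cols X"]) simp
  \<comment> \<open>Positivity includes hermiticity, so the prescribed spectrum comes with an
    orthonormal eigenbasis, and the norm equals the lower bound valid for every Parseval
    frame.\<close>
  have item2: "N (F * mat_adjoint (synthesis n xs) - 1\<^sub>m n)
      \<le> N (F * mat_adjoint (synthesis n ys) - 1\<^sub>m n)"
    if xs: "length xs = m" "is_parseval_frame n xs" "psd n (F * mat_adjoint (synthesis n xs))"
      "has_eigenvalues (F * mat_adjoint (synthesis n xs)) (map (\<lambda>j. sqrt (d j)) [0..<n])"
      and N: "unitarily_invariant_norm n N" and ys: "length ys = m" "is_parseval_frame n ys"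
    for xs ys N
  proof -
    obtain w where w: "eigsys n (F * mat_adjoint (synthesis n xs)) w (\<lambda>j. sqrt (d j))"
      using spectral_theorem[OF prod[OF syn[OF xs(1)]] _ xs(4)] xs(3) by (auto simp: psd_def)
    have "N (F * mat_adjoint (synthesis n xs) - 1\<^sub>m n) = N (real_diag n (\<lambda>j. sqrt (d j) - 1))"
      by (rule uin_norm_eigsys[OF N c1[OF syn[OF xs(1)]] eigsys_minus_one[OF prod[OF syn[OF xs(1)]] w]])
    also have "\<dots> \<le> N (F * mat_adjoint (synthesis n ys) - 1\<^sub>m n)"
      by (rule bound[OF N syn[OF ys(1)] parseval_frame_coisometry[OF ys(2)]])
    finally show ?thesis .
  qed
  have item3: "alpha n N fs \<in> parseval_errors n m N F \<and>
      alpha n N fs = \<Phi> (vec n (\<lambda>j. 1 - sqrt (d j)))"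
    if N: "unitarily_invariant_norm n N" and \<Phi>: "associated_gauge n N \<Phi>" for N \<Phi>
  proof -
    have mem: "N (F * mat_adjoint X - 1\<^sub>m n) \<in> parseval_errors n m N F"
      unfolding parseval_errors_def using X by blast
    \<comment> \<open>The infimum is a minimum: the error of the optimal \<open>X\<close> is both a
      member and a lower bound of the set.\<close>
    have "alpha n N fs = N (F * mat_adjoint X - 1\<^sub>m n)"
      unfolding alpha_def assms(2) assms(3)[symmetric]
    proof (rule cInf_eq_minimum[OF mem])
      fix t assume "t \<in> parseval_errors n m N F"
      then obtain Y where "Y \<in> carrier_mat n m" "Y * mat_adjoint Y = 1\<^sub>m n"
        and t: "t = N (F * mat_adjoint Y - 1\<^sub>m n)"
        unfolding parseval_errors_def by blast
      then show "N (F * mat_adjoint X - 1\<^sub>m n) \<le> t"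
        using uin_norm_eigsys[OF N c1[OF X(1)] e1] bound[OF N] by simp
    qed
    moreover have "N (F * mat_adjoint X - 1\<^sub>m n) = \<Phi> (vec n (\<lambda>j. sqrt (d j) - 1))"
      by (rule associated_gauge_eigsys[OF \<Phi> c1[OF X(1)] e1])
    \<comment> \<open>The eigenvalues of the error have the opposite sign of the entries in the
      claim; homogeneity with the scalar -1 reconciles them.\<close>
    moreover have "\<Phi> (vec n (\<lambda>j. sqrt (d j) - 1)) = \<Phi> (vec n (\<lambda>j. 1 - sqrt (d j)))"
    proof -
      have "\<Phi> ((-1) \<cdot>\<^sub>v vec n (\<lambda>j. sqrt (d j) - 1)) = \<bar>-1\<bar> * \<Phi> (vec n (\<lambda>j. sqrt (d j) - 1))"
        using \<Phi> unfolding associated_gauge_def symmetric_gauge_def by (meson vec_carrier)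
      moreover have "(-1) \<cdot>\<^sub>v vec n (\<lambda>j. sqrt (d j) - 1) = vec n (\<lambda>j. 1 - sqrt (d j))"
        by (intro eq_vecI) auto
      ultimately show ?thesis by simp
    qed
    ultimately show ?thesis using mem by simp
  qed
  show ?thesis using pos item1 item2 item3 by blast
qed

end
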